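(* Let $S$ be a folding string and let $\theta$ be its associated folding morphism. Then $S$ is self-avoiding if and only if the $\theta$-loop of $S$ is a simple (closed) curve.
   Context: A folding string is a finite word $S=a_1\ldots a_{m-1}$ ($m\ge 2$) over $\{D,U\}$ with first letter $a_1=D$; such an $S$ codes an $m$-fold. $\overline{S}$ is the word obtained from $S$ by reversing it and exchanging $D$ and $U$. For $S=a_1\ldots a_{s-1}$ and $T=b_1\ldots b_{t-1}$ the folding convolution is $S*T=S\,b_1\,\overline{S}\,b_2\,S\,b_3\,\overline{S}\cdots b_{t-1}X$, in which $t$ blocks alternate between $S$ and $\overline S$ beginning with $S$ (so $X=\overline S$ if $t$ is even, $X=S$ if $t$ is odd). This operation is associative; $S^{*1}=S$, $S^{*(n+1)}=S^{*n}*S$. Since $S^{*n}$ is a prefix of $S^{*(n+1)}$, there is an infinite sequence $S^{*\infty}$ having all $S^{*n}$ as prefixes. Let $A=\{a,b,c,d\}$. $\sigma$ is the morphism of $A^*$ with $\sigma(a)=b,\sigma(b)=c,\sigma(c)=d,\sigma(d)=a$, and $\tau$ is the reversal of words in $A^*$. Let $w:\{D,U\}^*\to\mathbb{Z}$ be the homomorphism with $w(D)=1$, $w(U)=-1$. The folding morphism $\theta=\theta_S:A^*\to A^*$ associated to $S$ is the morphism commuting with $\sigma\tau$ such that $\theta(a)=e_0\ldots e_{m-1}$ with $e_0=a$ and $e_i=\sigma^{w(a_1\ldots a_i)}(a)$ for $1\le i\le m-1$; thus $\theta(b)=\sigma\tau\theta(a)$, $\theta(c)=\sigma^2\theta(a)$,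 $\theta(d)=\sigma^3\tau\theta(a)$. Let $f:A^*\to\mathbb{C}$ be the homomorphism (concatenation to addition) with $f(a)=1,f(b)=i,f(c)=-1,f(d)=-i$. A finite or infinite word $u_0u_1u_2\ldots$ over $A$ determines a lattice path starting at $p_0=0$ with $p_{j+1}=p_j+f(u_j)$, traversing successively the unit segments $[p_j,p_{j+1}]$; $K[u]$ denotes this curve (as a set, the union of these segments). The curve associated to an infinite sequence $a_1a_2a_3\ldots$ over $\{D,U\}$ is the path of the infinite word $e_0e_1e_2\ldots$ with $e_0=a$, $e_i=\sigma^{w(a_1\ldots a_i)}(a)$. $S$ is self-avoiding if the curve associated to $S^{*\infty}$ does not traverse any unit segment twice (in either direction). The $\theta$-loop is the closed curve $\widetilde K[\theta(abcd)]$, where $\widetilde K[u]$ is obtained from $K[u]$ by rounding off its corners: at each vertex of the path (all consecutive segments are perpendicular) the corner is cut off near the vertex, so that the curve does not pass through Gaussian integers; for the closed path $\theta(abcd)$ this is also done at the base point $0$. Thus the $\theta$-loop is simple if and only if the closed path of $\theta(abcd)$ does not traverse any unit segment twice. *)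

theory Defs
  imports "HOL-Analysis.Analysis" "HOL-Library.Sublist"
begin

section \<open>Folding strings and their convolution\<close>

datatype dir = D | U

fun flip :: "dir \<Rightarrow> dir" where
  "flip D = U"
| "flip U = D"

definition folding_string :: "dir list \<Rightarrow> bool" where
  "folding_string S \<longleftrightarrow> S \<noteq> [] \<and> hd S = D"

definition bar :: "dir list \<Rightarrow> dir list" where
  "bar S = rev (map flip S)"

text \<open>Since \<open>bar\<close> is an involution, recursing with \<open>bar S\<close> in place of \<open>S\<close> makes the
  blocks alternate between \<open>S\<close> and \<open>bar S\<close>.\<close>

fun fold_conv :: "dir list \<Rightarrow> dir list \<Rightarrow> dir list" where
  "fold_conv S [] = S"
| "fold_conv S (b # T) = S @ b # fold_conv (bar S) T"

text \<open>The empty word is neutral for \<open>fold_conv\<close>, so starting the recursion at exponent \<open>0\<close>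
  gives the intended powers for exponents at least \<open>1\<close>.\<close>

fun fold_pow :: "dir list \<Rightarrow> nat \<Rightarrow> dir list" where
  "fold_pow S 0 = []"
| "fold_pow S (Suc n) = fold_conv (fold_pow S n) S"

text \<open>The limit word, indexed from \<open>0\<close>. For \<open>S \<noteq> []\<close> the power with exponent \<open>k + 1\<close> has
  more than \<open>k\<close> letters; the lemma \<open>fold_limit_prefix\<close> below shows that all powers are
  prefixes of the limit.\<close>

definition fold_limit :: "dir list \<Rightarrow> nat \<Rightarrow> dir" where
  "fold_limit S k = fold_pow S (Suc k) ! k"

lemma fold_pow_1: "fold_pow S (Suc 0) = S"
proof -
  have "fold_conv [] T = T" for T
    by (induction T) (simp_all add: bar_def)
  then show ?thesis by simp
qed

lemma prefix_fold_conv: "prefix S (fold_conv S T)"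
  by (cases T) simp_all

lemma prefix_fold_pow: "m \<le> n \<Longrightarrow> prefix (fold_pow S m) (fold_pow S n)"
proof (induction n rule: dec_induct)
  case (step n)
  then show ?case
    using prefix_fold_conv prefix_order.trans by fastforce
qed simp

lemma length_fold_pow:
  assumes "S \<noteq> []"
  shows "n \<le> length (fold_pow S n)"
proof (induction n)
  case (Suc n)
  obtain b T where "S = b # T" using assms by (cases S) auto
  then show ?case using Suc by simp
qed simp

lemma fold_limit_prefix:
  assumes "S \<noteq> []" and "k < length (fold_pow S n)"
  shows "fold_limit S k = fold_pow S n ! k"
proof -
  have *: "k < length (fold_pow S (Suc k))"
    using length_fold_pow[OF assms(1), of "Suc k"] by simp
  have "prefix (fold_pow S n) (fold_pow S (Suc k)) \<or> prefix (fold_pow S (Suc k)) (fold_pow S n)"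
    using prefix_fold_pow le_cases by metis
  then show ?thesis
    unfolding fold_limit_def using * assms(2)
    by (auto simp: prefix_def nth_append simp del: fold_pow.simps)
qed


section \<open>Lattice words and the folding morphism\<close>

datatype letter = La | Lb | Lc | Ld

fun sigma :: "letter \<Rightarrow> letter" where
  "sigma La = Lb"
| "sigma Lb = Lc"
| "sigma Lc = Ld"
| "sigma Ld = La"

text \<open>Integer powers of \<open>sigma\<close>, which has order \<open>4\<close>.\<close>

definition sigma_pow :: "int \<Rightarrow> letter \<Rightarrow> letter" where
  "sigma_pow k = sigma ^^ nat (k mod 4)"

fun dir_weight :: "dir \<Rightarrow> int" where
  "dir_weight D = 1"
| "dir_weight U = -1"

definition weight :: "dir list \<Rightarrow> int" where
  "weight S = sum_list (map dir_weight S)"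

text \<open>The word \<open>e\<^sub>0 e\<^sub>1 e\<^sub>2 \<dots>\<close> of a sequence over \<open>{D, U}\<close>. The sequence is indexed
  from \<open>0\<close>, so that \<open>e\<^sub>i\<close> depends on the letters with indices below \<open>i\<close>.\<close>

definition edge_seq :: "(nat \<Rightarrow> dir) \<Rightarrow> nat \<Rightarrow> letter" where
  "edge_seq s i = sigma_pow (weight (map s [0..<i])) La"

definition edge_word :: "dir list \<Rightarrow> letter list" where
  "edge_word S = map (edge_seq ((!) S)) [0..<Suc (length S)]"

fun theta_letter :: "dir list \<Rightarrow> letter \<Rightarrow> letter list" where
  "theta_letter S La = edge_word S"
| "theta_letter S Lb = map sigma (rev (edge_word S))"
| "theta_letter S Lc = map (sigma ^^ 2) (edge_word S)"
| "theta_letter S Ld = map (sigma ^^ 3) (rev (edge_word S))"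

definition theta :: "dir list \<Rightarrow> letter list \<Rightarrow> letter list" where
  "theta S u = concat (map (theta_letter S) u)"

lemma theta_append: "theta S (u @ v) = theta S u @ theta S v"
  by (simp add: theta_def)

lemma theta_sigma_rev: "theta S (map sigma (rev u)) = map sigma (rev (theta S u))"
proof -
  have 4: "sigma (sigma (sigma (sigma x))) = x" for x by (cases x) simp_all
  have "theta_letter S (sigma x) = map sigma (rev (theta_letter S x))" for x
    by (cases x) (simp_all add: numeral_2_eq_2 numeral_3_eq_3 rev_map 4 comp_def)
  then show ?thesis
    by (simp add: theta_def rev_concat map_concat rev_map comp_def)
qed


section \<open>Curves\<close>

fun step :: "letter \<Rightarrow> complex" where
  "step La = 1"
| "step Lb = \<i>"
| "step Lc = -1"
| "step Ld = -\<i>"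

definition vertex :: "(nat \<Rightarrow> letter) \<Rightarrow> nat \<Rightarrow> complex" where
  "vertex u j = (\<Sum>i<j. step (u i))"

definition segment :: "(nat \<Rightarrow> letter) \<Rightarrow> nat \<Rightarrow> complex set" where
  "segment u j = closed_segment (vertex u j) (vertex u (Suc j))"

text \<open>Segments are compared as point sets, so both orientations of a traversal are covered.\<close>

definition self_avoiding :: "dir list \<Rightarrow> bool" where
  "self_avoiding S \<longleftrightarrow> inj (segment (edge_seq (fold_limit S)))"

fun polygonal_path :: "complex list \<Rightarrow> real \<Rightarrow> complex" where
  "polygonal_path [] = linepath 0 0"
| "polygonal_path [x] = linepath x x"
| "polygonal_path [x, y] = linepath x y"
| "polygonal_path (x # y # z # zs) = linepath x y +++ polygonal_path (y # z # zs)"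

text \<open>The curve obtained from the closed lattice path of a word \<open>u\<close> by cutting every corner,
  including the one at the base point, by the straight line between the two points at distance
  \<open>r\<close> from the vertex, where \<open>0 < r < 1/2\<close>. What remains of the \<open>j\<close>-th unit segment runs from
  \<open>p\<^sub>j + r f(u\<^sub>j)\<close> to \<open>p\<^sub>j\<^sub>+\<^sub>1 - r f(u\<^sub>j)\<close>, where \<open>f\<close> is the function \<open>step\<close>.
  The last segment of the polygonal path cuts the corner at the base point.\<close>

definition rounded_points :: "real \<Rightarrow> letter list \<Rightarrow> complex list" where
  "rounded_points r u =
     concat (map (\<lambda>j. [vertex ((!) u) j + of_real r * step (u ! j),
                       vertex ((!) u) (Suc j) - of_real r * step (u ! j)]) [0..<length u])"

definition rounded_loop :: "real \<Rightarrow> letter list \<Rightarrow> real \<Rightarrow> complex" where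
  "rounded_loop r u = polygonal_path (rounded_points r u @ [hd (rounded_points r u)])"

definition theta_loop :: "real \<Rightarrow> dir list \<Rightarrow> real \<Rightarrow> complex" where
  "theta_loop r S = rounded_loop r (theta S [La, Lb, Lc, Ld])"

text \<open>The lattice path of \<open>theta S [La, Lb, Lc, Ld]\<close> is closed, as \<open>rounded_loop\<close> requires.\<close>

lemma vertex_nth: "vertex ((!) u) (length u) = sum_list (map step u)"
  by (simp add: vertex_def sum_list_sum_nth atLeast0LessThan)

lemma theta_abcd_closed:
  "vertex ((!) (theta S [La, Lb, Lc, Ld])) (length (theta S [La, Lb, Lc, Ld])) = 0"
proof -
  have 1: "step (sigma x) = \<i> * step x" for x by (cases x) simp_all
  have 2: "(\<Sum>x\<leftarrow>u. - f x) = - (\<Sum>x\<leftarrow>u. f x)" for f :: "letter \<Rightarrow> complex" and u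
    by (induction u) simp_all
  show ?thesis
    unfolding vertex_nth theta_def
    by (simp add: rev_map[symmetric] comp_def 1 2 sum_list_const_mult
        numeral_2_eq_2 numeral_3_eq_3)
qed

end

theory Submission
  imports Defs
begin

text \<open>
  All steps of lattice paths are written as complex numbers \<open>1, \<i>, -1, -\<i>\<close>. Let \<open>\<gamma>\<close> be the path
  of \<open>\<theta>(a)\<close>, let \<open>m\<close> be its number of steps and \<open>z\<close> its end point. Associativity of the convolution
  makes the curve of \<open>S\<close> a fixed point of \<open>\<theta>\<close> (lemma \<open>edge_seq_fixed_point\<close>), and the loop is \<open>\<theta>\<close>
  applied to a unit square. On a grid edge \<open>\<theta>\<close> acts as follows. Call a lattice point even if the sum of
  its coordinates is even. Every grid edge has exactly one even end point \<open>v\<close>, from which it points in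
  some direction \<open>d\<close>, and \<open>\<theta>\<close> replaces it by the arm \<open>z v + d \<gamma>\<close>, traversed backwards if the walk runs towards \<open>v\<close>
  (lemma \<open>edge_refine\<close>). So whether two grid edges have arms with a common unit segment depends only
  on their relative position, up to quarter turns about even points and translations between even
  points.

  A self-avoiding curve gives a loop without repetition (lemma \<open>loop_edge_inj_of_curve\<close>). Up to these
  motions there are only four kinds of pairs of sides of a unit square: adjacent at an even or at an
  odd point, and two kinds of opposite pairs. Adjacent pairs appear at each turn of the curve. The
  opposite pairs appear wherever the curve turns twice in the same direction; which kind it is depends
  on the direction and on the parity of the position, and both kinds occur (lemma
  \<open>fold_limit_equal_turns\<close>). Hence a segment repeated in the loop is repeated in the curve.

  For the converse let the loop be without repetition. Its rounding is a Jordan curve and encloses a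
  finite set \<open>F\<close> of unit cells, which lie on one and the same side of the loop all along it (lemma
  \<open>closed_walk_encloses\<close>). The signed area enclosed by the loop is \<open>\<bar>z\<bar>\<^sup>2\<close>: opposite arms are congruent,
  while adjacent ones deviate from their chords in opposite directions, so their deviations cancel.
  This area is not negative, so \<open>F\<close> lies on the left and has \<open>\<bar>z\<bar>\<^sup>2\<close> elements (lemma \<open>enclosed_area\<close>).
  Now let \<open>\<Lambda>\<close> be the lattice of all \<open>(1 + \<i>) z a\<close> with \<open>a\<close> a Gaussian integer. The translates of \<open>F\<close>
  by \<open>\<Lambda>\<close> belong to half of the unit squares of the grid, those of \<open>-\<i> F\<close> to the other half. Every
  arm bounds one translate of each family, from opposite sides, so the number of translates that
  contain a given cell does not change across a unit segment and is constant. Since \<open>\<Lambda>\<close> has index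
  \<open>2 \<bar>z\<bar>\<^sup>2\<close> (lemma \<open>box_sum_lat\<close>) and \<open>F\<close> and \<open>-\<i> F\<close> together have \<open>2 \<bar>z\<bar>\<^sup>2\<close> cells, the constant is
  \<open>1\<close> (lemma \<open>cover_once\<close>): the translates tile the plane. Consequently arms of different grid edges
  have no common segment (lemma \<open>translates_disjoint\<close>), and a segment that the curve traverses at the
  times \<open>j \<noteq> k\<close> forces one that it traverses at the times \<open>j div m \<noteq> k div m\<close>, which cannot go on
  forever (lemma \<open>curve_edge_inj\<close>).

  Finally, the pieces of a rounded closed walk meet only where they are consecutive, unless the walk
  traverses a unit segment twice. So the rounded loop is simple exactly if the loop is without
  repetition (lemma \<open>simple_path_marks_iff\<close>).
\<close>


section \<open>Block structure of the limit word\<close>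

lemma flip_flip [simp]: "flip (flip x) = x" by (cases x) simp_all
lemma bar_bar [simp]: "bar (bar S) = S" by (simp add: bar_def rev_map comp_def)
lemma length_bar [simp]: "length (bar S) = length S" by (simp add: bar_def)
lemma bar_nil [simp]: "bar [] = []" by (simp add: bar_def)
lemma bar_append: "bar (S @ T) = bar T @ bar S" by (simp add: bar_def)
lemma bar_Cons: "bar (b # T) = bar T @ [flip b]" by (simp add: bar_def)

lemma bar_nth: "i < length S \<Longrightarrow> bar S ! i = flip (S ! (length S - 1 - i))"
  by (simp add: bar_def rev_nth)

text \<open>
  The number of blocks before the joint \<open>b\<close> is \<open>length T + 1\<close>, and its parity decides whether the
  alternation resumes with \<open>S\<close> or with \<open>bar S\<close>.
\<close>

lemma fold_conv_append_Cons:
  "fold_conv S (T @ b # R) = fold_conv S T @ b # fold_conv (if even (length T) then bar S else S) R"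
  by (induction T arbitrary: S) auto

text \<open>
  Read backwards, the blocks still alternate, but they start with the former last one.
\<close>

lemma bar_fold_conv:
  "bar (fold_conv S T) = fold_conv (if even (length T) then bar S else S) (bar T)"
  by (induction T arbitrary: S)
    (auto simp: bar_append bar_Cons fold_conv_append_Cons)

lemma fold_conv_assoc: "fold_conv (fold_conv S T) R = fold_conv S (fold_conv T R)"
proof (induction R arbitrary: S T)
  case (Cons b R)
  then show ?case by (simp add: fold_conv_append_Cons bar_fold_conv)
qed simp

lemma fold_conv_Nil: "fold_conv [] T = T"
  by (induction T) simp_all

text \<open>
  With the factor \<open>S\<close> on the left the blocks have the fixed length of \<open>S\<close>, independently of \<open>n\<close>.
\<close>

lemma fold_pow_Suc': "fold_pow S (Suc n) = fold_conv S (fold_pow S n)"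
  by (induction n) (simp_all add: fold_conv_Nil fold_conv_assoc)

lemma length_fold_conv: "length (fold_conv S T) = Suc (length S) * length T + length S"
  by (induction T arbitrary: S) auto

lemma fold_conv_nth:
  assumes "j \<le> length T" "i < length S"
  shows "fold_conv S T ! (Suc (length S) * j + i) = (if even j then S else bar S) ! i"
  using assms
proof (induction T arbitrary: S j)
  case (Cons b T)
  show ?case
  proof (cases j)
    case 0 then show ?thesis using Cons.prems by (simp add: nth_append)
  next
    case (Suc k)
    have "fold_conv S (b # T) ! (Suc (length S) * j + i)
        = fold_conv (bar S) T ! (Suc (length (bar S)) * k + i)"
      by (simp add: nth_append Suc add.assoc)
    then show ?thesis using Cons.IH[of k "bar S"] Cons.prems Suc by auto
  qed
qed simp

lemma fold_conv_nth_joint: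
  assumes "j < length T"
  shows "fold_conv S T ! (Suc (length S) * j + length S) = T ! j"
  using assms
proof (induction T arbitrary: S j)
  case (Cons b T)
  show ?case
  proof (cases j)
    case (Suc k)
    have "fold_conv S (b # T) ! (Suc (length S) * j + length S)
        = fold_conv (bar S) T ! (Suc (length (bar S)) * k + length (bar S))"
      by (simp add: nth_append Suc add.assoc)
    then show ?thesis using Cons.IH[of k "bar S"] Cons.prems Suc by simp
  qed (simp add: nth_append)
qed simp

text \<open>
  This lemma and the next one express that the limit word is unchanged by convolution with \<open>S\<close> from
  the left: its blocks come from \<open>S\<close>, and its joints spell the limit word itself.
\<close>

lemma fold_limit_block:
  assumes "S \<noteq> []" "i < length S"
  shows "fold_limit S (Suc (length S) * j + i) = (if even j then S else bar S) ! i"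
proof -
  have j: "j \<le> length (fold_pow S j)" using length_fold_pow[OF assms(1)] .
  have "Suc (length S) * j + i < length (fold_pow S (Suc j))"
    unfolding fold_pow_Suc' length_fold_conv using j assms(2)
    by (meson add_le_less_mono mult_le_mono2)
  then have "fold_limit S (Suc (length S) * j + i) = fold_pow S (Suc j) ! (Suc (length S) * j + i)"
    by (rule fold_limit_prefix[OF assms(1)])
  then show ?thesis unfolding fold_pow_Suc' using fold_conv_nth[OF j assms(2)] by simp
qed

lemma fold_limit_joint:
  assumes "S \<noteq> []"
  shows "fold_limit S (Suc (length S) * j + length S) = fold_limit S j"
proof -
  have j: "j < length (fold_pow S (Suc j))" using length_fold_pow[OF assms(1), of "Suc j"] by simp
  then have "Suc j \<le> length (fold_pow S (Suc j))" by simp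
  then have "Suc (length S) * Suc j \<le> Suc (length S) * length (fold_pow S (Suc j))"
    by (rule mult_le_mono2)
  then have "Suc (length S) * j + length S < length (fold_pow S (Suc (Suc j)))"
    unfolding fold_pow_Suc'[of S "Suc j"] length_fold_conv by simp
  then have "fold_limit S (Suc (length S) * j + length S)
      = fold_pow S (Suc (Suc j)) ! (Suc (length S) * j + length S)"
    by (rule fold_limit_prefix[OF assms(1)])
  also have "\<dots> = fold_pow S (Suc j) ! j"
    unfolding fold_pow_Suc'[of S "Suc j"] by (rule fold_conv_nth_joint[OF j])
  finally show ?thesis by (simp only: fold_limit_def)
qed


section \<open>Lattice walks and their refinement\<close>

definition pos :: "(nat \<Rightarrow> complex) \<Rightarrow> nat \<Rightarrow> complex" where
  "pos f k = (\<Sum>l<k. f l)"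

definition block :: "(nat \<Rightarrow> complex) \<Rightarrow> nat \<Rightarrow> nat \<Rightarrow> nat \<Rightarrow> complex" where
  "block g m t i = (if even t then g i else g (m - 1 - i))"

text \<open>
  The effect of \<open>\<theta>\<close> on a sequence \<open>f\<close> of steps, where \<open>g\<close> lists the \<open>m\<close> steps of \<open>\<theta>(a)\<close>. Since \<open>\<theta>\<close>
  commutes with \<open>\<sigma>\<tau>\<close>, the letters in odd positions are replaced by the rotated word in reverse order.
  The steps themselves are not negated, so the reversed block still leads from \<open>0\<close> to the same end
  point (lemma \<open>pos_block_full\<close>).
\<close>

definition refine :: "(nat \<Rightarrow> complex) \<Rightarrow> nat \<Rightarrow> (nat \<Rightarrow> complex) \<Rightarrow> nat \<Rightarrow> complex" where
  "refine g m f k = f (k div m) * block g m (k div m) (k mod m)"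

lemma pos_0 [simp]: "pos f 0 = 0" by (simp add: pos_def)
lemma pos_Suc [simp]: "pos f (Suc k) = pos f k + f k" by (simp add: pos_def)

lemma pos_add: "pos f (a + b) = pos f a + pos (\<lambda>l. f (a + l)) b"
  by (induction b) (simp_all add: algebra_simps)

lemma pos_scale: "pos (\<lambda>l. c * f l) b = c * pos f b"
  by (induction b) (simp_all add: algebra_simps)

lemma pos_rev: "i \<le> m \<Longrightarrow> pos (\<lambda>l. g (m - 1 - l)) i = pos g m - pos g (m - i)"
proof (induction i)
  case (Suc i)
  then have "m - i = Suc (m - Suc i)" by simp
  with Suc show ?case by simp
qed simp

lemma pos_block:
  "i \<le> m \<Longrightarrow> pos (block g m t) i = (if even t then pos g i else pos g m - pos g (m - i))"
  using pos_rev[of i m g] by (simp add: block_def[abs_def])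

lemma pos_block_full [simp]: "pos (block g m t) m = pos g m"
  by (simp add: pos_block)

lemma refine_nth: "i < m \<Longrightarrow> refine g m f (m * t + i) = f t * block g m t i"
  by (simp add: refine_def)

lemma pos_cong: "(\<And>l. l < k \<Longrightarrow> f l = f' l) \<Longrightarrow> pos f k = pos f' k"
  by (simp add: pos_def)

lemma pos_refine_block: "i \<le> m \<Longrightarrow> pos (\<lambda>l. refine g m f (m * t + l)) i = f t * pos (block g m t) i"
  using pos_cong[of i "\<lambda>l. refine g m f (m * t + l)" "\<lambda>l. f t * block g m t l"]
  by (simp add: refine_nth pos_scale)

lemma pos_refine_mult: "pos (refine g m f) (m * t) = pos g m * pos f t"
proof (induction t)
  case (Suc t)
  have e: "m * Suc t = m * t + m" by simp
  have "pos (refine g m f) (m * Suc t) = pos g m * pos f t + f t * pos g m"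
    unfolding e using pos_add[of "refine g m f" "m * t" m] pos_refine_block[of m m g f t] Suc by simp
  then show ?case by (simp add: algebra_simps)
qed simp

lemma pos_refine:
  "i \<le> m \<Longrightarrow> pos (refine g m f) (m * t + i) = pos g m * pos f t + f t * pos (block g m t) i"
  by (simp add: pos_add pos_refine_block pos_refine_mult)


definition dirs :: "complex set" where "dirs = {1, \<i>, -1, -\<i>}"

definition turning :: "(nat \<Rightarrow> complex) \<Rightarrow> bool" where
  "turning f \<longleftrightarrow> (\<forall>k. f k \<in> dirs \<and> (f (Suc k) = \<i> * f k \<or> f (Suc k) = - \<i> * f k))"

lemma dirs_mult: "a \<in> dirs \<Longrightarrow> b \<in> dirs \<Longrightarrow> a * b \<in> dirs"
  by (auto simp: dirs_def)

lemma dirs_simps [simp]: "1 \<in> dirs" "\<i> \<in> dirs" "-1 \<in> dirs" "-\<i> \<in> dirs"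
  by (simp_all add: dirs_def)

lemma dirs_uminus [simp]: "- a \<in> dirs \<longleftrightarrow> a \<in> dirs"
  by (auto simp: dirs_def minus_equation_iff[of a])

lemma dirs_nonzero: "a \<in> dirs \<Longrightarrow> a \<noteq> 0"
  by (auto simp: dirs_def)

lemma step_dirs [simp]: "step x \<in> dirs"
  by (cases x) (simp_all add: dirs_def)

lemma step_sigma: "step (sigma x) = \<i> * step x"
  by (cases x) simp_all

fun turn :: "dir \<Rightarrow> complex" where
  "turn D = \<i>"
| "turn U = - \<i>"

lemma turn_flip [simp]: "turn (flip x) = - turn x"
  by (cases x) simp_all

lemma step_sigma_pow: "step (sigma_pow (k + dir_weight x) a) = turn x * step (sigma_pow k a)"
proof -
  have "k mod 4 = 0 \<or> k mod 4 = 1 \<or> k mod 4 = 2 \<or> k mod 4 = 3" by presburger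
  moreover have "(k + dir_weight x) mod 4 = (k mod 4 + dir_weight x) mod 4"
    by (simp add: mod_add_left_eq)
  ultimately show ?thesis
    by (cases x; cases a) (auto simp: sigma_pow_def numeral_2_eq_2 numeral_3_eq_3)
qed

lemma edge_seq_0 [simp]: "edge_seq s 0 = La"
  by (simp add: edge_seq_def weight_def sigma_pow_def)

lemma step_edge_seq_Suc: "step (edge_seq s (Suc k)) = turn (s k) * step (edge_seq s k)"
  using step_sigma_pow[of "weight (map s [0..<k])" "s k" La]
  by (simp add: edge_seq_def weight_def)

lemma edge_seq_turning: "turning (\<lambda>k. step (edge_seq s k))"
  unfolding turning_def
  by (metis step_dirs step_edge_seq_Suc turn.simps dir.exhaust)


definition fold_steps :: "dir list \<Rightarrow> nat \<Rightarrow> complex" where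
  "fold_steps S i = step (edge_seq ((!) S) i)"

text \<open>
  Both sides start with the step \<open>1\<close> and turn alike: inside a block the turns are those of \<open>S\<close> or
  \<open>bar S\<close>, and reversing the order of the steps of \<open>\<theta>(a)\<close> reverses and flips its turns; at a joint the
  limit word has the letter that stands between the two refined steps.
\<close>

lemma edge_seq_fixed_point:
  assumes "S \<noteq> []"
  defines "c \<equiv> \<lambda>k. step (edge_seq (fold_limit S) k)"
  shows "refine (fold_steps S) (Suc (length S)) c = c"
proof
  fix k
  let ?g = "fold_steps S" and ?m = "Suc (length S)"
  have g: "?g (Suc i) = turn (S ! i) * ?g i" for i
    by (simp add: fold_steps_def step_edge_seq_Suc)
  have c: "c (Suc k) = turn (fold_limit S k) * c k" for k
    by (simp add: c_def step_edge_seq_Suc)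
  have turn2: "turn x * turn x = -1" for x by (cases x) simp_all
  show "refine ?g ?m c k = c k"
  proof (induction k)
    case 0 then show ?case by (simp add: refine_def block_def c_def fold_steps_def)
  next
    case (Suc k)
    define t i where "t = k div ?m" and "i = k mod ?m"
    have k: "k = ?m * t + i" by (simp only: t_def i_def mult_div_mod_eq)
    have i: "i < ?m" by (simp add: i_def)
    have "refine ?g ?m c (Suc k) = turn (fold_limit S k) * refine ?g ?m c k"
    proof (cases "i < length S")
      case True
      have "Suc k = ?m * t + Suc i" using k by simp
      then have 1: "refine ?g ?m c (Suc k) = c t * block ?g ?m t (Suc i)"
        using refine_nth[of "Suc i" ?m ?g c t] True by simp
      have 2: "refine ?g ?m c k = c t * block ?g ?m t i"
        unfolding k using i by (rule refine_nth)
      have 3: "fold_limit S k = (if even t then S else bar S) ! i"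
        unfolding k by (rule fold_limit_block[OF assms(1) True])
      have "block ?g ?m t (Suc i) = turn (fold_limit S k) * block ?g ?m t i"
      proof (cases "even t")
        case True then show ?thesis by (simp add: block_def 3 g)
      next
        case False
        have e: "length S - i = Suc (length S - 1 - i)" using True by simp
        have "?g (length S - i) = turn (S ! (length S - 1 - i)) * ?g (length S - Suc i)"
          unfolding e g by simp
        then show ?thesis
          using False True by (simp add: block_def 3 bar_nth mult.assoc[symmetric] turn2)
      qed
      then show ?thesis by (simp add: 1 2)
    next
      case False
      with i have i': "i = length S" by simp
      have "Suc k = ?m * Suc t + 0" using k i' by simp
      then have 1: "refine ?g ?m c (Suc k) = c (Suc t) * block ?g ?m (Suc t) 0"
        using refine_nth[of 0 ?m ?g c "Suc t"] by simp
      have 2: "refine ?g ?m c k = c t * block ?g ?m t i"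
        unfolding k using i by (rule refine_nth)
      have 3: "fold_limit S k = fold_limit S t"
        unfolding k i' by (rule fold_limit_joint[OF assms(1)])
      show ?thesis by (simp add: 1 2 3 c block_def i')
    qed
    then show ?case by (simp add: Suc c)
  qed
qed

text \<open>
  Because the blocks alternate in direction, the two steps that meet at a joint come from the same
  entry of \<open>g\<close>. Hence the walk turns there exactly as \<open>f\<close> does.
\<close>

lemma refine_turning:
  assumes g: "turning g" and f: "turning f" and m: "m > 0"
  shows "turning (refine g m f)"
  unfolding turning_def
proof (intro allI conjI)
  fix k
  define t i where "t = k div m" and "i = k mod m"
  have k: "k = m * t + i" by (simp only: t_def i_def mult_div_mod_eq)
  have i: "i < m" using m by (simp add: i_def)
  have rk: "refine g m f k = f t * block g m t i"
    unfolding k using i by (rule refine_nth)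
  then show "refine g m f k \<in> dirs"
    using g f by (auto simp: turning_def block_def intro!: dirs_mult)
  show "refine g m f (Suc k) = \<i> * refine g m f k \<or> refine g m f (Suc k) = - \<i> * refine g m f k"
  proof (cases "Suc i < m")
    case True
    have "Suc k = m * t + Suc i" using k by simp
    then have 1: "refine g m f (Suc k) = f t * block g m t (Suc i)"
      using refine_nth[of "Suc i" m g f t] True by simp
    have e: "m - Suc i = Suc (m - Suc (Suc i))" using True by simp
    have "g (Suc i) = \<i> * g i \<or> g (Suc i) = - \<i> * g i"
      "g (m - Suc i) = \<i> * g (m - Suc (Suc i)) \<or> g (m - Suc i) = - \<i> * g (m - Suc (Suc i))"
      using g unfolding turning_def e by blast+
    then show ?thesis unfolding 1 rk block_def by (auto simp: algebra_simps)
  next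
    case False
    with i have i': "i = m - 1" by simp
    have "Suc k = m * Suc t + 0" using k i' m by simp
    then have 1: "refine g m f (Suc k) = f (Suc t) * block g m (Suc t) 0"
      using refine_nth[of 0 m g f "Suc t"] m by simp
    have "f (Suc t) = \<i> * f t \<or> f (Suc t) = - \<i> * f t" using f unfolding turning_def by blast
    then show ?thesis unfolding 1 rk block_def i' using m by (auto simp: algebra_simps)
  qed
qed

text \<open>
  The steps of \<open>\<theta>(abcd)\<close>, repeated periodically; \<open>\<i> ^ t\<close> runs around the unit square.
\<close>

definition loop :: "dir list \<Rightarrow> nat \<Rightarrow> complex" where
  "loop S = refine (fold_steps S) (Suc (length S)) (\<lambda>t. \<i> ^ t)"

lemma length_theta_abcd: "length (theta S [La, Lb, Lc, Ld]) = 4 * Suc (length S)"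
  by (simp add: theta_def edge_word_def)

lemma step_theta_abcd:
  assumes "k < 4 * Suc (length S)"
  shows "step (theta S [La, Lb, Lc, Ld] ! k) = loop S k"
proof -
  let ?m = "Suc (length S)"
  let ?W = "[edge_word S, map sigma (rev (edge_word S)), map (sigma ^^ 2) (edge_word S),
    map (sigma ^^ 3) (rev (edge_word S))]"
  define t i where "t = k div ?m" and "i = k mod ?m"
  have k: "k = ?m * t + i" by (simp only: t_def i_def mult_div_mod_eq)
  have i: "i < ?m" by (simp add: i_def)
  have t: "t < 4" using assms unfolding t_def by (simp add: less_mult_imp_div_less)
  have len: "length (edge_word S) = ?m" by (simp add: edge_word_def)
  have e: "edge_word S ! i = edge_seq ((!) S) i" if "i < ?m" for i
    unfolding edge_word_def using that by (simp del: upt_Suc)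
  have s: "step ((sigma ^^ n) x) = \<i> ^ n * step x" for n x
    by (induction n) (simp_all add: step_sigma)
  have r: "rev (edge_word S) ! i = edge_seq ((!) S) (?m - 1 - i)" if "i < ?m" for i
    using that len by (simp add: rev_nth e)
  have th: "theta S [La, Lb, Lc, Ld] = edge_word S @ map sigma (rev (edge_word S)) @
     map (sigma ^^ 2) (edge_word S) @ map (sigma ^^ 3) (rev (edge_word S))"
    by (simp add: theta_def)
  have "loop S k = \<i> ^ t * block (fold_steps S) ?m t i"
    unfolding loop_def k using i by (rule refine_nth)
  moreover have "step (theta S [La, Lb, Lc, Ld] ! k) = \<i> ^ t * block (fold_steps S) ?m t i"
  proof -
    consider "t = 0" | "t = 1" | "t = 2" | "t = 3" using t by linarith
    then show ?thesis
    proof cases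
      case 1
      then have "theta S [La, Lb, Lc, Ld] ! k = edge_word S ! i"
        unfolding th k using i len by (simp add: nth_append)
      then show ?thesis using 1 i by (simp add: e block_def fold_steps_def)
    next
      case 2
      then have "theta S [La, Lb, Lc, Ld] ! k = sigma (rev (edge_word S) ! i)"
        unfolding th k using i len by (simp add: nth_append)
      then show ?thesis using 2 i by (simp add: r block_def fold_steps_def step_sigma)
    next
      case 3
      then have "theta S [La, Lb, Lc, Ld] ! k = (sigma ^^ 2) (edge_word S ! i)"
        unfolding th k using i len by (simp add: nth_append)
      then show ?thesis using 3 i by (simp add: e block_def fold_steps_def s)
    next
      case 4
      then have "theta S [La, Lb, Lc, Ld] ! k = (sigma ^^ 3) (rev (edge_word S) ! i)"
        unfolding th k using i len by (simp add: nth_append)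
      then show ?thesis using 4 i by (simp add: r block_def fold_steps_def s)
    qed
  qed
  ultimately show ?thesis by simp
qed

text \<open>
  The two kinds of double turns are exchanged if the parity of the position or the direction is
  changed. The block \<open>bar S\<close> in second place ends with \<open>U\<close> at an even position and is followed by some
  letter and then, at the beginning of the third block, by \<open>D\<close>; whatever the letter is, it equals one
  of its neighbours, and this is a double turn of the second kind. Without any double turn of the
  first kind the limit word would be \<open>DUDU\<dots>\<close>, with \<open>D\<close> at all even positions.
\<close>


section \<open>From the curve to the loop\<close>

lemma fold_limit_equal_turns:
  assumes "folding_string S"
  shows "\<exists>t. (even t \<and> fold_limit S t = D \<or> odd t \<and> fold_limit S t = U) \<and>
             fold_limit S (Suc t) = fold_limit S t"
    and "\<exists>t. (even t \<and> fold_limit S t = U \<or> odd t \<and> fold_limit S t = D) \<and>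
             fold_limit S (Suc t) = fold_limit S t"
proof -
  let ?s = "fold_limit S" and ?n = "length S"
  have ne: "S \<noteq> []" and S0: "S ! 0 = D"
    using assms by (auto simp: folding_string_def hd_conv_nth)
  then have n: "?n > 0" by simp
  have s0: "?s 0 = D" using fold_limit_block[OF ne n, of 0] S0 by simp
  have "Suc ?n * 1 + (?n - 1) = 2 * ?n" using n by simp
  \<comment> \<open>The last letter of the second block, which is \<open>bar S\<close>.\<close>
  then have a: "?s (2 * ?n) = U"
    using fold_limit_block[OF ne, of "?n - 1" 1] n S0 by (simp add: bar_nth)
  have "Suc ?n * 1 + ?n = Suc (2 * ?n)" by simp
  then have b: "?s (Suc (2 * ?n)) = ?s 1" using fold_limit_joint[OF ne, of 1] by metis
  have "Suc ?n * 2 + 0 = Suc (Suc (2 * ?n))" by simp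
  then have c: "?s (Suc (Suc (2 * ?n))) = D" using fold_limit_block[OF ne n, of 2] S0 by (simp add: mult.commute)
  show "\<exists>t. (even t \<and> ?s t = U \<or> odd t \<and> ?s t = D) \<and> ?s (Suc t) = ?s t"
  proof (cases "?s 1")
    case D
    then have "?s (Suc (2 * ?n)) = D" using b by simp
    with c show ?thesis by (intro exI[of _ "Suc (2 * ?n)"]) simp
  next
    case U
    then have "?s (Suc (2 * ?n)) = U" using b by simp
    with a show ?thesis by (intro exI[of _ "2 * ?n"]) simp
  qed
  show "\<exists>t. (even t \<and> ?s t = D \<or> odd t \<and> ?s t = U) \<and> ?s (Suc t) = ?s t"
  proof (rule ccontr)
    assume none: "\<not> ?thesis"
    have "?s t = (if even t then D else U)" for t
    proof (induction t)
      case (Suc t)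
      then have "?s (Suc t) \<noteq> ?s t" using none by (metis dir.distinct(1))
      with Suc show ?case by (cases "?s (Suc t)") (auto split: if_splits)
    qed (simp add: s0)
    from this[of "2 * ?n"] a show False by simp
  qed
qed


type_synonym edge = "complex \<times> complex"

definition edge :: "(nat \<Rightarrow> complex) \<Rightarrow> nat \<Rightarrow> edge" where
  "edge f k = (pos f k, f k)"

definition rev_edge :: "edge \<Rightarrow> edge" where
  "rev_edge e = (fst e + snd e, - snd e)"

definition same_edge :: "edge \<Rightarrow> edge \<Rightarrow> bool" where
  "same_edge e e' \<longleftrightarrow> e' = e \<or> e' = rev_edge e"

definition edge_inj :: "(nat \<Rightarrow> complex) \<Rightarrow> nat set \<Rightarrow> bool" where
  "edge_inj f A \<longleftrightarrow> (\<forall>j\<in>A. \<forall>k\<in>A. same_edge (edge f j) (edge f k) \<longrightarrow> j = k)"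

lemma rev_rev_edge [simp]: "rev_edge (rev_edge e) = e"
  by (simp add: rev_edge_def)

lemma rev_edge_eq_iff: "rev_edge e = e' \<longleftrightarrow> e = rev_edge e'"
  by auto

lemma same_edge_rev [simp]:
  "same_edge (rev_edge e) e' \<longleftrightarrow> same_edge e e'" "same_edge e (rev_edge e') \<longleftrightarrow> same_edge e e'"
  by (auto simp: same_edge_def rev_edge_eq_iff)

lemma same_edge_sym: "same_edge e e' \<longleftrightarrow> same_edge e' e"
  by (auto simp: same_edge_def)

lemma same_edge_iff_segment:
  "same_edge (p, f) (q, h) \<longleftrightarrow> closed_segment p (p + f) = closed_segment q (q + h)"
  by (auto simp: same_edge_def rev_edge_def doubleton_eq_iff add_eq_0_iff algebra_simps)

lemma segment_eq_iff:
  "segment u j = segment u k \<longleftrightarrow> same_edge (edge (\<lambda>k. step (u k)) j) (edge (\<lambda>k. step (u k)) k)"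
  by (simp add: edge_def same_edge_iff_segment segment_def vertex_def pos_def del: closed_segment_eq)

lemma self_avoiding_iff_edge_inj:
  "self_avoiding S \<longleftrightarrow> edge_inj (\<lambda>k. step (edge_seq (fold_limit S) k)) UNIV"
  by (simp add: self_avoiding_def inj_on_def segment_eq_iff edge_inj_def)


text \<open>
  The edges of the copy of the path of \<open>g\<close> that starts at the image of the lattice point \<open>v\<close> and is
  turned into the direction \<open>d\<close>.
\<close>

definition arm :: "(nat \<Rightarrow> complex) \<Rightarrow> nat \<Rightarrow> complex \<Rightarrow> complex \<Rightarrow> nat \<Rightarrow> edge" where
  "arm g m v d i = (pos g m * v + d * pos g i, d * g i)"

text \<open>
  The even end point of the \<open>t\<close>-th edge of a walk from the origin, and the direction in which the edge
  leaves that point.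
\<close>

definition base :: "(nat \<Rightarrow> complex) \<Rightarrow> nat \<Rightarrow> complex" where
  "base f t = (if even t then pos f t else pos f (Suc t))"

definition aim :: "(nat \<Rightarrow> complex) \<Rightarrow> nat \<Rightarrow> complex" where
  "aim f t = (if even t then f t else - f t)"

text \<open>
  A reversed block that runs from \<open>v\<close> to \<open>v + d\<close> is the path of \<open>g\<close> started at \<open>v + d\<close> in direction
  \<open>-d\<close> and traversed backwards. In this form all refined edges look alike.
\<close>

lemma edge_refine:
  assumes "i < m"
  shows "edge (refine g m f) (m * t + i) =
    (if even t then arm g m (base f t) (aim f t) i
     else rev_edge (arm g m (base f t) (aim f t) (m - 1 - i)))"
proof -
  have "m - i = Suc (m - 1 - i)" using assms by simp
  then have "pos g (m - i) = pos g (m - 1 - i) + g (m - 1 - i)"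
    by (simp only: pos_Suc)
  then show ?thesis
    unfolding edge_def pos_refine[OF less_imp_le[OF assms]] refine_nth[OF assms]
      pos_block[OF less_imp_le[OF assms]]
    by (simp add: arm_def base_def aim_def rev_edge_def block_def algebra_simps)
qed

definition clash :: "(nat \<Rightarrow> complex) \<Rightarrow> nat \<Rightarrow> edge \<Rightarrow> edge \<Rightarrow> bool" where
  "clash g m e e' \<longleftrightarrow> (\<exists>i<m. \<exists>j<m. same_edge (arm g m (fst e) (snd e) i) (arm g m (fst e') (snd e') j))"

lemma clash_sym: "clash g m e e' \<Longrightarrow> clash g m e' e"
  unfolding clash_def using same_edge_sym by blast

text \<open>
  The similarity \<open>q \<mapsto> c q + z w\<close>, where \<open>z\<close> is the end point of the path of \<open>g\<close>, maps arms to arms and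
  respects edges.
\<close>

lemma same_edge_arm_similar:
  assumes "same_edge (arm g m v d i) (arm g m v' d' j)"
  shows "same_edge (arm g m (c * v + w) (c * d) i) (arm g m (c * v' + w) (c * d') j)"
proof -
  define \<psi> where "\<psi> e = (c * fst e + pos g m * w, c * snd e)" for e :: edge
  have 1: "arm g m (c * v + w) (c * d) i = \<psi> (arm g m v d i)" for v d i
    by (simp add: \<psi>_def arm_def algebra_simps)
  have 2: "\<psi> (rev_edge e) = rev_edge (\<psi> e)" for e
    by (simp add: \<psi>_def rev_edge_def algebra_simps)
  show ?thesis using assms unfolding 1 same_edge_def by (auto simp: 2)
qed

lemma clash_similar:
  "clash g m (v, d) (v', d') \<Longrightarrow> clash g m (c * v + w, c * d) (c * v' + w, c * d')"
  unfolding clash_def fst_conv snd_conv using same_edge_arm_similar by metis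

lemma same_arms_index:
  assumes inj: "edge_inj (refine g m f) A" and ij: "i < m" "j < m"
    and A: "{m * t ..< m * Suc t} \<subseteq> A" "{m * t' ..< m * Suc t'} \<subseteq> A"
    and same: "same_edge (arm g m (base f t) (aim f t) i) (arm g m (base f t') (aim f t') j)"
  shows "t = t' \<and> i = j"
proof -
  define x where "x t i = (if even t then i else m - 1 - i)" for t i :: nat
  have x: "x t i < m" if "i < m" for t i using that by (auto simp: x_def)
  have xx: "x t (x t i) = i" if "i < m" for t i using that by (auto simp: x_def)
  have e: "edge (refine g m f) (m * t + x t i) =
    (if even t then arm g m (base f t) (aim f t) i else rev_edge (arm g m (base f t) (aim f t) i))"
    if "i < m" for t i
    using edge_refine[OF x[OF that], of g f t t] that by (simp add: x_def)
  have "same_edge (edge (refine g m f) (m * t + x t i)) (edge (refine g m f) (m * t' + x t' j))"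
    using same unfolding e[OF ij(1)] e[OF ij(2)] by simp
  moreover have "m * t + x t i \<in> A" "m * t' + x t' j \<in> A"
    using A x[OF ij(1), of t] x[OF ij(2), of t'] by auto
  ultimately have eq: "m * t + x t i = m * t' + x t' j"
    using inj unfolding edge_inj_def by blast
  have "t = (m * t + x t i) div m" "t' = (m * t' + x t' j) div m"
    using x[OF ij(1), of t] x[OF ij(2), of t'] by simp_all
  then have "t = t'" using eq by simp
  with eq have "x t i = x t j" by simp
  then have "i = j" using xx[OF ij(1), of t] xx[OF ij(2), of t] by metis
  with \<open>t = t'\<close> show ?thesis ..
qed

lemma refine_edge_arm:
  assumes "m > 0"
  obtains i where "i < m" "k = m * (k div m) + (if even (k div m) then i else m - 1 - i)"
    "edge (refine g m f) k = arm g m (base f (k div m)) (aim f (k div m)) i \<or>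
     edge (refine g m f) k = rev_edge (arm g m (base f (k div m)) (aim f (k div m)) i)"
proof -
  define t j where "t = k div m" and "j = k mod m"
  have k: "k = m * t + j" by (simp only: t_def j_def mult_div_mod_eq)
  have j: "j < m" using assms by (simp add: j_def)
  show thesis
    by (rule that[of "if even t then j else m - 1 - j"])
      (use j edge_refine[OF j, of g f t] in \<open>auto simp: k\<close>)
qed

lemma no_clash_of_edge_inj:
  assumes "edge_inj (refine g m f) UNIV" "t \<noteq> t'"
  shows "\<not> clash g m (base f t, aim f t) (base f t', aim f t')"
  using same_arms_index[OF assms(1)] assms(2) unfolding clash_def by auto

lemma no_clash_of_similar:
  assumes "\<not> clash g m (v, d) (v', d')" "v = c * u + w" "d = c * e" "v' = c * u' + w" "d' = c * e'"
  shows "\<not> clash g m (u, e) (u', e')"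
  using assms clash_similar by blast

lemma pos_square:
  "pos (\<lambda>t. \<i> ^ t) 1 = 1" "pos (\<lambda>t. \<i> ^ t) 2 = 1 + \<i>" "pos (\<lambda>t. \<i> ^ t) 3 = \<i>"
  "pos (\<lambda>t. \<i> ^ t) 4 = 0"
  by (simp_all add: eval_nat_numeral)

lemma square_sides:
  defines "q \<equiv> \<lambda>t. \<i> ^ t"
  shows "base q 0 = 0" "base q 1 = 1 + \<i>" "base q 2 = 1 + \<i>" "base q 3 = 0"
    "aim q 0 = 1" "aim q 1 = - \<i>" "aim q 2 = -1" "aim q 3 = \<i>"
  by (simp_all add: q_def base_def aim_def pos_square power3_eq_cube)

text \<open>
  It suffices to exclude common edges for one representative of each congruence class of pairs of
  sides of the unit square: \<open>A0\<close> and \<open>B0\<close> for adjacent sides, \<open>X0\<close> and \<open>Y0\<close> for opposite sides. Each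
  representative is similar to a pair of edges of \<open>f\<close>, taken at distance one for adjacent sides and at
  distance two, around a double turn, for opposite ones.
\<close>

lemma loop_edge_inj_of_curve:
  fixes s :: "nat \<Rightarrow> dir" and f :: "nat \<Rightarrow> complex"
  assumes inj: "edge_inj (refine g m f) UNIV"
    and f0: "f 0 = 1" and f: "\<And>t. f (Suc t) = turn (s t) * f t"
    and X: "\<exists>t. (even t \<and> s t = D \<or> odd t \<and> s t = U) \<and> s (Suc t) = s t"
    and Y: "\<exists>t. (even t \<and> s t = U \<or> odd t \<and> s t = D) \<and> s (Suc t) = s t"
  shows "edge_inj (refine g m (\<lambda>t. \<i> ^ t)) {..<4 * m}"
proof -
  let ?q = "\<lambda>t. \<i> ^ t"
  note nc = no_clash_of_edge_inj[OF inj]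
  note sim = no_clash_of_similar
  let ?a = "\<lambda>t. (base f t, aim f t)"
  have A0: "\<not> clash g m (0, 1) (0, \<i>)"
  proof -
    have b: "base f 2 = base f 1" by (simp add: base_def numeral_2_eq_2)
    have "aim f 2 = turn (s 1) * f 1" using f[of 1] by (simp add: aim_def numeral_2_eq_2)
    moreover have "aim f 1 = - f 1" by (simp add: aim_def)
    moreover have "turn (s 1) = \<i> \<or> turn (s 1) = - \<i>" by (cases "s 1") simp_all
    ultimately consider "aim f 1 = aim f 2 * \<i>" | "aim f 2 = aim f 1 * \<i>"
      by (metis mult.commute complex_i_mult_minus mult_minus_left)
    then show ?thesis
    proof cases
      case 1
      have "\<not> clash g m (?a 2) (?a 1)" by (rule nc) simp
      then show ?thesis
        by (rule sim[where c = "aim f 2" and w = "base f 2"]) (use b 1 in simp_all)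
    next
      case 2
      have "\<not> clash g m (?a 1) (?a 2)" by (rule nc) simp
      then show ?thesis
        by (rule sim[where c = "aim f 1" and w = "base f 1"]) (use b 2 in simp_all)
    qed
  qed
  have B0: "\<not> clash g m (0, 1) (1 + \<i>, - \<i>)"
  proof -
    have f1: "f 1 = turn (s 0) * f 0" using f[of 0] by simp
    have v: "base f 0 = 0" "aim f 0 = 1" "aim f 1 = - turn (s 0)" "base f 1 = 1 + turn (s 0)"
      using f1 by (simp_all add: base_def aim_def f0)
    show ?thesis
    proof (cases "s 0")
      case D
      have "\<not> clash g m (?a 0) (?a 1)" by (rule nc) simp
      then show ?thesis using v by (simp add: D)
    next
      case U
      have "\<not> clash g m (?a 1) (?a 0)" by (rule nc) simp
      then show ?thesis
        by (rule sim[where c = \<i> and w = "1 - \<i>"]) (use v U in \<open>simp_all add: algebra_simps\<close>)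
    qed
  qed
  have X0: "\<not> clash g m (0, 1) (1 + \<i>, - 1)"
  proof -
    obtain t where t: "even t \<and> s t = D \<or> odd t \<and> s t = U" "s (Suc t) = s t" using X by blast
    have "\<not> clash g m (base f t, aim f t) (base f (Suc (Suc t)), aim f (Suc (Suc t)))"
      by (rule nc) simp
    then show ?thesis
    proof (rule sim[where c = "aim f t" and w = "base f t"])
      have fs: "f (Suc t) = turn (s t) * f t" "f (Suc (Suc t)) = turn (s t) * (turn (s t) * f t)"
        using f[of t] f[of "Suc t"] t(2) by simp_all
      show "base f (Suc (Suc t)) = aim f t * (1 + \<i>) + base f t"
        using t(1) by (elim disjE conjE) (simp_all add: base_def aim_def fs algebra_simps)
      show "aim f (Suc (Suc t)) = aim f t * - 1"
        using t(1) by (elim disjE conjE) (simp_all add: aim_def fs)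
    qed simp_all
  qed
  have Y0: "\<not> clash g m (0, 1) (1 - \<i>, - 1)"
  proof -
    obtain t where t: "even t \<and> s t = U \<or> odd t \<and> s t = D" "s (Suc t) = s t" using Y by blast
    have "\<not> clash g m (base f t, aim f t) (base f (Suc (Suc t)), aim f (Suc (Suc t)))"
      by (rule nc) simp
    then show ?thesis
    proof (rule sim[where c = "aim f t" and w = "base f t"])
      have fs: "f (Suc t) = turn (s t) * f t" "f (Suc (Suc t)) = turn (s t) * (turn (s t) * f t)"
        using f[of t] f[of "Suc t"] t(2) by simp_all
      show "base f (Suc (Suc t)) = aim f t * (1 - \<i>) + base f t"
        using t(1) by (elim disjE conjE) (simp_all add: base_def aim_def fs algebra_simps)
      show "aim f (Suc (Suc t)) = aim f t * - 1"
        using t(1) by (elim disjE conjE) (simp_all add: aim_def fs)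
    qed simp_all
  qed
  have A1: "\<not> clash g m (1 + \<i>, - \<i>) (1 + \<i>, -1)"
  proof -
    have "\<not> clash g m (0, \<i>) (0, 1)" using A0 clash_sym by blast
    then show ?thesis by (rule sim[where c = "-1" and w = "1 + \<i>"]) simp_all
  qed
  have B1: "\<not> clash g m (1 + \<i>, -1) (0, \<i>)"
    by (rule sim[OF B0, where c = "-1" and w = "1 + \<i>"]) simp_all
  have Y1: "\<not> clash g m (1 + \<i>, - \<i>) (0, \<i>)"
    by (rule sim[OF Y0, where c = "\<i>" and w = "1 - \<i>"]) (simp_all add: algebra_simps)
  let ?b = "\<lambda>t. (base ?q t, aim ?q t)"
  have "\<not> clash g m (?b t) (?b t')" if "t < t'" "t' < 4" for t t'
  proof -
    consider "t = 0" "t' = 1" | "t = 0" "t' = 2" | "t = 0" "t' = 3" |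
      "t = 1" "t' = 2" | "t = 1" "t' = 3" | "t = 2" "t' = 3"
      using \<open>t < t'\<close> \<open>t' < 4\<close> by linarith
    then show ?thesis
      by cases (simp_all only: square_sides A0 B0 X0 A1 B1 Y1 not_False_eq_True)
  qed
  then have sides: "t = t'" if "clash g m (?b t) (?b t')" "t < 4" "t' < 4" for t t'
    using that clash_sym[of g m "?b t" "?b t'"] by (cases t t' rule: linorder_cases) blast+
  have same_side: "i = j"
    if ij: "i < m" "j < m" and same: "same_edge (arm g m v d i) (arm g m v d j)" and d: "d \<noteq> 0"
    for i j v d
  proof -
    have "same_edge (arm g m (base f 0) (aim f 0) i) (arm g m (base f 0) (aim f 0) j)"
      using same_edge_arm_similar[OF same, of "inverse d" "- inverse d * v"] d f0
      by (simp add: base_def aim_def)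
    from same_arms_index[OF inj ij _ _ this] show "i = j" by simp
  qed
  show ?thesis unfolding edge_inj_def
  proof (intro ballI impI)
    fix j k assume j: "j \<in> {..<4 * m}" and k: "k \<in> {..<4 * m}"
      and same: "same_edge (edge (refine g m ?q) j) (edge (refine g m ?q) k)"
    have m: "m > 0" using j by (cases m) auto
    obtain x where x: "x < m" "j = m * (j div m) + (if even (j div m) then x else m - 1 - x)"
      "edge (refine g m ?q) j = arm g m (base ?q (j div m)) (aim ?q (j div m)) x \<or>
       edge (refine g m ?q) j = rev_edge (arm g m (base ?q (j div m)) (aim ?q (j div m)) x)"
      by (rule refine_edge_arm[OF m])
    obtain y where y: "y < m" "k = m * (k div m) + (if even (k div m) then y else m - 1 - y)"
      "edge (refine g m ?q) k = arm g m (base ?q (k div m)) (aim ?q (k div m)) y \<or>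
       edge (refine g m ?q) k = rev_edge (arm g m (base ?q (k div m)) (aim ?q (k div m)) y)"
      by (rule refine_edge_arm[OF m])
    have same': "same_edge (arm g m (base ?q (j div m)) (aim ?q (j div m)) x)
        (arm g m (base ?q (k div m)) (aim ?q (k div m)) y)"
      using same x(3) y(3) by auto
    then have "clash g m (?b (j div m)) (?b (k div m))"
      using x(1) y(1) unfolding clash_def by auto
    then have t: "j div m = k div m"
      by (rule sides) (use j k in \<open>auto simp: less_mult_imp_div_less\<close>)
    have "aim ?q (k div m) \<noteq> 0" by (simp add: aim_def)
    then have "x = y" using same_side[OF x(1) y(1)] same' t by simp
    show "j = k" by (rule trans[OF x(2)[unfolded t \<open>x = y\<close>] y(2)[symmetric]])
  qed
qed


section \<open>The index of a lattice of Gaussian integers\<close>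

definition gauss :: "complex set" where "gauss = {z. Re z \<in> \<int> \<and> Im z \<in> \<int>}"

lemma gauss_simps [simp]:
  "0 \<in> gauss" "1 \<in> gauss" "\<i> \<in> gauss" "of_nat n \<in> gauss" "of_int k \<in> gauss"
  "- a \<in> gauss \<longleftrightarrow> a \<in> gauss" "cnj a \<in> gauss \<longleftrightarrow> a \<in> gauss"
  by (auto simp: gauss_def minus_in_Ints_iff)

lemma gauss_add [simp, intro]: "a \<in> gauss \<Longrightarrow> b \<in> gauss \<Longrightarrow> a + b \<in> gauss"
  and gauss_diff [simp, intro]: "a \<in> gauss \<Longrightarrow> b \<in> gauss \<Longrightarrow> a - b \<in> gauss"
  and gauss_mult [simp, intro]: "a \<in> gauss \<Longrightarrow> b \<in> gauss \<Longrightarrow> a * b \<in> gauss"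
  by (auto simp: gauss_def)

lemma gauss_sum [intro]: "(\<And>x. x \<in> A \<Longrightarrow> f x \<in> gauss) \<Longrightarrow> sum f A \<in> gauss"
  by (induction A rule: infinite_finite_induct) auto

lemma dirs_gauss [simp]: "d \<in> dirs \<Longrightarrow> d \<in> gauss"
  by (auto simp: dirs_def)

lemma gauss_cases:
  assumes "a \<in> gauss"
  obtains x y :: int where "a = of_int x + \<i> * of_int y"
proof -
  obtain x y :: int where "Re a = of_int x" "Im a = of_int y"
    using assms by (auto simp: gauss_def elim!: Ints_cases)
  then show thesis by (intro that[of x y]) (simp add: complex_eq_iff)
qed

lemma periodic_of_int:
  fixes H :: "complex \<Rightarrow> 'a"
  assumes "\<And>b. H (b + c) = H b"
  shows "H (b + of_int k * c) = H b"
proof -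
  have nat: "H (b + of_nat n * c) = H b" for b n
  proof (induction n)
    case (Suc n)
    have "H (b + of_nat (Suc n) * c) = H ((b + of_nat n * c) + c)" by (simp add: algebra_simps)
    then show ?case by (simp only: assms Suc)
  qed simp
  show ?thesis
  proof (cases k rule: int_cases2)
    case (nonneg n) then show ?thesis using nat[of b n] by simp
  next
    case (nonpos n) then show ?thesis using nat[of "b - of_nat n * c" n] by simp
  qed
qed

lemma periodic_gauss:
  fixes H :: "complex \<Rightarrow> 'a"
  assumes "\<And>b. H (b + 1) = H b" "\<And>b. H (b + \<i>) = H b" "a \<in> gauss"
  shows "H (b + a) = H b"
proof -
  obtain x y :: int where a: "a = of_int x + \<i> * of_int y" using assms(3) by (rule gauss_cases)
  have "H (b + a) = H ((b + of_int x * 1) + of_int y * \<i>)" by (simp add: a algebra_simps)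
  also have "\<dots> = H (b + of_int x * 1)" by (rule periodic_of_int) (rule assms(2))
  also have "\<dots> = H b" by (rule periodic_of_int) (rule assms(1))
  finally show ?thesis .
qed


definition grid :: "nat \<times> nat \<Rightarrow> complex" where
  "grid u = of_nat (fst u) + \<i> * of_nat (snd u)"

definition box_sum :: "nat \<Rightarrow> (complex \<Rightarrow> real) \<Rightarrow> complex \<Rightarrow> real" where
  "box_sum n h b = (\<Sum>u\<in>{..<n} \<times> {..<n}. h (b + grid u))"

text \<open>
  The indicator function of the ideal generated by \<open>\<beta>\<close>, with real values because it is summed and
  compared with areas.
\<close>

definition lat :: "complex \<Rightarrow> complex \<Rightarrow> real" where
  "lat \<beta> x = of_bool (\<exists>a\<in>gauss. x = \<beta> * a)"

lemma grid_gauss [simp]: "grid u \<in> gauss"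
  by (auto simp: grid_def)

lemma box_sum_shift:
  assumes "\<And>x. h (x + of_nat n) = h x" "\<And>x. h (x + \<i> * of_nat n) = h x" "a \<in> gauss"
  shows "box_sum n h (b + a) = box_sum n h b"
proof (rule periodic_gauss)
  have cyc: "(\<Sum>s<n. \<phi> (Suc s)) = (\<Sum>s<n. \<phi> s)" if "\<phi> n = \<phi> 0" for \<phi> :: "nat \<Rightarrow> real"
    using sum.lessThan_Suc_shift[of \<phi> n] that by simp
  have nest: "box_sum n h b = (\<Sum>s<n. \<Sum>t<n. h (b + (of_nat s + \<i> * of_nat t)))" for b
    by (simp add: box_sum_def sum.cartesian_product grid_def case_prod_unfold)
  show "box_sum n h (b + 1) = box_sum n h b" for b
  proof -
    have "box_sum n h (b + 1) = (\<Sum>s<n. (\<lambda>s. \<Sum>t<n. h (b + (of_nat s + \<i> * of_nat t))) (Suc s))"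
      by (simp add: nest algebra_simps)
    also have "\<dots> = box_sum n h b"
      unfolding nest by (rule cyc) (rule sum.cong, use assms(1) in \<open>simp_all add: algebra_simps\<close>,
        use assms(1) in \<open>metis add.assoc add.commute\<close>)
    finally show ?thesis .
  qed
  show "box_sum n h (b + \<i>) = box_sum n h b" for b
  proof -
    have "box_sum n h (b + \<i>) = (\<Sum>s<n. \<Sum>t<n. (\<lambda>t. h (b + (of_nat s + \<i> * of_nat t))) (Suc t))"
      by (simp add: nest algebra_simps)
    also have "\<dots> = box_sum n h b"
      unfolding nest
    proof (rule sum.cong[OF refl], rule cyc)
      fix s
      show "h (b + (of_nat s + \<i> * of_nat n)) = h (b + (of_nat s + \<i> * of_nat 0))"
        using assms(2)[of "b + of_nat s"] by (simp add: algebra_simps)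
    qed
    finally show ?thesis .
  qed
qed (rule assms(3))

lemma lat_add: "a \<in> gauss \<Longrightarrow> lat \<beta> (x + \<beta> * a) = lat \<beta> x"
proof -
  assume a: "a \<in> gauss"
  have "(\<exists>b\<in>gauss. x + \<beta> * a = \<beta> * b) \<longleftrightarrow> (\<exists>b\<in>gauss. x = \<beta> * b)"
  proof
    assume "\<exists>b\<in>gauss. x + \<beta> * a = \<beta> * b"
    then obtain b where "b \<in> gauss" "x + \<beta> * a = \<beta> * b" by blast
    then show "\<exists>b\<in>gauss. x = \<beta> * b" using a by (intro bexI[of _ "b - a"]) (auto simp: algebra_simps)
  next
    assume "\<exists>b\<in>gauss. x = \<beta> * b"
    then obtain b where "b \<in> gauss" "x = \<beta> * b" by blast
    then show "\<exists>b\<in>gauss. x + \<beta> * a = \<beta> * b"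
      using a by (intro bexI[of _ "b + a"]) (auto simp: algebra_simps)
  qed
  then show ?thesis by (simp add: lat_def)
qed

lemma lat_unit:
  assumes "c * c' = 1" "c \<in> gauss" "c' \<in> gauss"
  shows "lat \<beta> (c * x) = lat \<beta> x"
proof -
  have "(\<exists>b\<in>gauss. c * x = \<beta> * b) \<longleftrightarrow> (\<exists>b\<in>gauss. x = \<beta> * b)"
  proof
    assume "\<exists>b\<in>gauss. c * x = \<beta> * b"
    then obtain b where b: "b \<in> gauss" "c * x = \<beta> * b" by blast
    have "x = (c * x) * c'" using assms(1) by (simp add: algebra_simps)
    then have "x = \<beta> * (b * c')" by (simp add: b)
    then show "\<exists>b\<in>gauss. x = \<beta> * b" using b assms(3) by blast
  next
    assume "\<exists>b\<in>gauss. x = \<beta> * b"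
    then obtain b where "b \<in> gauss" "x = \<beta> * b" by blast
    then show "\<exists>b\<in>gauss. c * x = \<beta> * b"
      using assms(2) by (intro bexI[of _ "c * b"]) (auto simp: algebra_simps)
  qed
  then show ?thesis by (simp add: lat_def)
qed

lemma lat_minus: "lat \<beta> (- x) = lat \<beta> x"
  using lat_unit[of "-1" "-1" \<beta> x] by simp

lemma lat_ii: "lat \<beta> (\<i> * x) = lat \<beta> x"
  using lat_unit[of "\<i>" "-\<i>" \<beta> x] by simp

lemma lat_cnj: "lat (cnj \<beta>) x = lat \<beta> (cnj x)"
proof -
  have "(\<exists>a\<in>gauss. x = cnj \<beta> * a) \<longleftrightarrow> (\<exists>a\<in>gauss. cnj x = \<beta> * a)"
    by (metis complex_cnj_cnj complex_cnj_mult gauss_simps(7))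
  then show ?thesis by (simp add: lat_def)
qed

lemma lat_periodic:
  assumes "\<beta> * cnj \<beta> = of_nat n" "\<beta> \<in> gauss"
  shows "lat \<beta> (x + of_nat n) = lat \<beta> x" "lat \<beta> (x + \<i> * of_nat n) = lat \<beta> x"
proof -
  show "lat \<beta> (x + of_nat n) = lat \<beta> x"
    using lat_add[of "cnj \<beta>" \<beta> x] assms by simp
  have "\<beta> * (\<i> * cnj \<beta>) = \<i> * of_nat n" using assms(1) by (simp add: algebra_simps)
  with lat_add[of "\<i> * cnj \<beta>" \<beta> x] assms(2)
  show "lat \<beta> (x + \<i> * of_nat n) = lat \<beta> x" by simp
qed

lemma box_sum_lat_shift:
  assumes "\<beta> * cnj \<beta> = of_nat n" "\<beta> \<in> gauss" "a \<in> gauss"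
  shows "box_sum n (lat \<beta>) a = box_sum n (lat \<beta>) 0"
  using box_sum_shift[of "lat \<beta>" n a 0] lat_periodic[OF assms(1,2)] assms(3) by simp

lemma box_sum_full_lattice:
  assumes "n > 0" "a \<in> gauss"
  shows "box_sum n (lat (of_nat n)) a = 1"
proof -
  have per: "lat (of_nat n) (x + of_nat n) = lat (of_nat n) x"
    "lat (of_nat n) (x + \<i> * of_nat n) = lat (of_nat n) x" for x
    using lat_add[of 1 "of_nat n" x] lat_add[of \<i> "of_nat n" x] by (simp_all add: mult.commute)
  have one: "lat (of_nat n) (0 + grid u) = of_bool (u = (0, 0))" if "u \<in> {..<n} \<times> {..<n}" for u
  proof -
    obtain s t where u: "u = (s, t)" by (cases u)
    have st: "s < n" "t < n" using that by (simp_all add: u)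
    have "s = 0 \<and> t = 0" if ag: "a \<in> gauss" and ga: "grid u = of_nat n * a" for a
    proof -
      obtain x y :: int where a: "a = of_int x + \<i> * of_int y" using ag by (rule gauss_cases)
      have "real s = real n * of_int x" "real t = real n * of_int y"
        using ga by (simp_all add: complex_eq_iff grid_def u a)
      then have "real_of_int (int s) = real_of_int (int n * x)"
        "real_of_int (int t) = real_of_int (int n * y)" by simp_all
      then have "int s = int n * x" "int t = int n * y" unfolding of_int_eq_iff .
      then have "int n dvd int s" "int n dvd int t" by simp_all
      then have "n dvd s" "n dvd t" by simp_all
      then show ?thesis using st by (auto dest: nat_dvd_not_less)
    qed
    moreover have "\<exists>a\<in>gauss. grid u = of_nat n * a" if "u = (0, 0)"
      using that by (intro bexI[of _ 0]) (simp_all add: grid_def)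
    ultimately show ?thesis unfolding lat_def u by auto
  qed
  have "box_sum n (lat (of_nat n)) a = box_sum n (lat (of_nat n)) 0"
    using box_sum_shift[of "lat (of_nat n)" n a 0] per assms(2) by simp
  also have "\<dots> = (\<Sum>u\<in>{..<n} \<times> {..<n}. of_bool (u = (0, 0)))"
    unfolding box_sum_def by (rule sum.cong[OF refl]) (rule one)
  also have "\<dots> = 1" using assms(1) by (simp add: of_bool_def)
  finally show ?thesis .
qed

text \<open>
  Complex conjugation maps the box to a translate of its mirror image, and translations do not matter.
\<close>

lemma box_sum_cnj:
  assumes "\<beta> * cnj \<beta> = of_nat n" "\<beta> \<in> gauss"
  shows "box_sum n (lat (cnj \<beta>)) 0 = box_sum n (lat \<beta>) 0"
proof -
  have "box_sum n (lat (cnj \<beta>)) 0 = (\<Sum>s<n. \<Sum>t<n. lat \<beta> (of_nat s - \<i> * of_nat t))"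
    by (simp add: box_sum_def lat_cnj sum.cartesian_product grid_def case_prod_unfold)
  also have "\<dots> = (\<Sum>s<n. \<Sum>t<n. lat \<beta> (of_nat s - \<i> * of_nat (n - Suc t)))"
    by (intro sum.cong refl sum.nat_diff_reindex[symmetric])
  also have "\<dots> = (\<Sum>s<n. \<Sum>t<n. lat \<beta> (- \<i> * of_nat (n - 1) + (of_nat s + \<i> * of_nat t)))"
    by (intro sum.cong refl arg_cong[where f = "lat \<beta>"]) (simp add: of_nat_diff algebra_simps)
  also have "\<dots> = box_sum n (lat \<beta>) (- \<i> * of_nat (n - 1))"
    by (simp only: box_sum_def sum.cartesian_product grid_def case_prod_unfold)
  also have "\<dots> = box_sum n (lat \<beta>) 0"
    by (rule box_sum_lat_shift[OF assms]) (auto intro!: gauss_mult)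
  finally show ?thesis .
qed

text \<open>
  The ideal generated by \<open>\<beta>\<close> has index \<open>n = \<beta> (cnj \<beta>)\<close>. Consider multiplication by \<open>\<beta>\<close> on the
  Gaussian integers modulo \<open>n\<close>, which form a group of order \<open>n\<^sup>2\<close>. Its image is the ideal of \<open>\<beta>\<close> modulo
  \<open>n\<close> and its kernel is the ideal of \<open>cnj \<beta>\<close> modulo \<open>n\<close>. Both have the same order \<open>K\<close>, by conjugation,
  so that \<open>n\<^sup>2 = K\<^sup>2\<close>. The proof carries this out as a double count of the pairs \<open>u, v\<close> of the box with
  \<open>v\<close> congruent to \<open>\<beta> u\<close>.
\<close>

lemma box_sum_lat:
  assumes \<beta>: "\<beta> * cnj \<beta> = of_nat n" "\<beta> \<in> gauss" and n: "n > 0" and a: "a \<in> gauss"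
  shows "box_sum n (lat \<beta>) a = n"
proof -
  let ?B = "{..<n} \<times> {..<n}"
  let ?K = "box_sum n (lat \<beta>) 0"
  have nz: "\<beta> \<noteq> 0" using \<beta>(1) n by auto
  have \<beta>': "cnj \<beta> * cnj (cnj \<beta>) = of_nat n" "cnj \<beta> \<in> gauss"
    using \<beta> by (simp_all add: mult.commute)
  have col: "(\<Sum>u\<in>?B. lat (of_nat n) (y - \<beta> * grid u)) = lat \<beta> y * ?K" for y
  proof (cases "\<exists>b\<in>gauss. y = \<beta> * b")
    case True
    then obtain b where b: "b \<in> gauss" "y = \<beta> * b" by blast
    have "lat (of_nat n) (y - \<beta> * grid u) = lat (cnj \<beta>) (- b + grid u)" for u
    proof -
      have "lat (of_nat n) (y - \<beta> * grid u) = lat (\<beta> * cnj \<beta>) (- (\<beta> * (- b + grid u)))"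
        unfolding \<beta>(1) b by (simp add: algebra_simps)
      also have "\<dots> = lat (cnj \<beta>) (- b + grid u)"
        unfolding lat_minus unfolding lat_def using nz by (simp add: mult.assoc)
      finally show ?thesis .
    qed
    then have "(\<Sum>u\<in>?B. lat (of_nat n) (y - \<beta> * grid u)) = box_sum n (lat (cnj \<beta>)) (- b)"
      by (simp add: box_sum_def)
    also have "\<dots> = ?K"
      using box_sum_lat_shift[OF \<beta>', of "- b"] b(1) box_sum_cnj[OF \<beta>] by simp
    finally show ?thesis using True by (simp add: lat_def)
  next
    case False
    have "lat (of_nat n) (y - \<beta> * grid u) = 0" for u
    proof (rule ccontr)
      assume "lat (of_nat n) (y - \<beta> * grid u) \<noteq> 0"
      then obtain b where "b \<in> gauss" "y - \<beta> * grid u = of_nat n * b"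
        by (auto simp: lat_def)
      then have "y = \<beta> * (grid u + cnj \<beta> * b)" "grid u + cnj \<beta> * b \<in> gauss"
        unfolding \<beta>(1)[symmetric] using \<beta>' by (auto simp: algebra_simps)
      then show False using False by blast
    qed
    then show ?thesis using False by (simp add: lat_def)
  qed
  have "real n * real n = (\<Sum>u\<in>?B. 1)" by simp
  also have "\<dots> = (\<Sum>u\<in>?B. box_sum n (lat (of_nat n)) (- \<beta> * grid u))"
    using box_sum_full_lattice[OF n] \<beta>(2) by (intro sum.cong refl) auto
  also have "\<dots> = (\<Sum>u\<in>?B. \<Sum>v\<in>?B. lat (of_nat n) (grid v - \<beta> * grid u))"
    by (simp add: box_sum_def)
  also have "\<dots> = (\<Sum>v\<in>?B. \<Sum>u\<in>?B. lat (of_nat n) (grid v - \<beta> * grid u))"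
    by (rule sum.swap)
  also have "\<dots> = ?K * ?K"
    unfolding col by (simp add: box_sum_def sum_distrib_right)
  finally have "(real n)\<^sup>2 = ?K\<^sup>2" by (simp add: power2_eq_square)
  moreover have "?K \<ge> 0" by (simp add: box_sum_def lat_def sum_nonneg)
  ultimately have "?K = n" by simp
  then show ?thesis using box_sum_lat_shift[OF \<beta> a] by simp
qed


section \<open>Cells enclosed by a closed walk\<close>

lemma sum_dirs: "sum \<phi> dirs = \<phi> 1 + \<phi> \<i> + \<phi> (-1) + \<phi> (- \<i>)"
  for \<phi> :: "complex \<Rightarrow> 'a :: comm_monoid_add"
  by (simp add: dirs_def complex_eq_iff add.assoc)

lemma finite_dirs [simp]: "finite dirs"
  by (simp add: dirs_def)

text \<open>
  The centres of the two unit cells beside an edge.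
\<close>

definition left :: "edge \<Rightarrow> complex" where
  "left e = fst e + snd e * ((1 + \<i>) / 2)"

definition right :: "edge \<Rightarrow> complex" where
  "right e = fst e + snd e * ((1 - \<i>) / 2)"

definition cells :: "complex set" where
  "cells = {c. c - (1 + \<i>) / 2 \<in> gauss}"

lemma left_rev_edge [simp]: "left (rev_edge e) = right e"
  and right_rev_edge [simp]: "right (rev_edge e) = left e"
  by (simp_all add: left_def right_def rev_edge_def field_simps)

lemma snd_rev_edge [simp]: "snd (rev_edge e) = - snd e"
  by (simp add: rev_edge_def)

lemma cells_minus_half_diagonal: "c - d * ((1 + \<i>) / 2) \<in> gauss" if "c \<in> cells" "d \<in> dirs"
proof -
  have "(1 - d) * ((1 + \<i>) / 2) \<in> gauss"
    using that(2) by (auto simp: dirs_def gauss_def)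
  moreover have "c - d * ((1 + \<i>) / 2) = (c - (1 + \<i>) / 2) + (1 - d) * ((1 + \<i>) / 2)"
    by (simp add: field_simps)
  ultimately show ?thesis using that(1) by (simp only: cells_def mem_Collect_eq gauss_add)
qed

text \<open>
  In the sum over the boundary edges of all cells in \<open>F\<close>, each taken with the cell on its left, an edge
  between two cells of \<open>F\<close> occurs in both orientations and cancels.
\<close>

lemma cells_stokes:
  fixes \<omega> :: "edge \<Rightarrow> real"
  assumes F: "finite F" and anti: "\<And>e. \<omega> (rev_edge e) = - \<omega> e"
  shows "(\<Sum>c\<in>F. \<Sum>d\<in>dirs. \<omega> (c - d * ((1 + \<i>) / 2), d)) =
    (\<Sum>e | snd e \<in> dirs \<and> left e \<in> F \<and> right e \<notin> F. \<omega> e)"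
proof -
  let ?X = "{e. snd e \<in> dirs \<and> left e \<in> F}"
  let ?Y = "{e \<in> ?X. right e \<in> F}"
  let ?h = "\<lambda>(c, d). (c - d * ((1 + \<i>) / 2), d)"
  have X: "?h ` (F \<times> dirs) = ?X"
  proof
    show "?h ` (F \<times> dirs) \<subseteq> ?X" by (auto simp: left_def)
    show "?X \<subseteq> ?h ` (F \<times> dirs)"
    proof
      fix e assume "e \<in> ?X"
      then show "e \<in> ?h ` (F \<times> dirs)"
        by (intro image_eqI[of _ _ "(left e, snd e)"]) (auto simp: left_def prod_eq_iff)
    qed
  qed
  have inj: "inj_on ?h (F \<times> dirs)" by (auto simp: inj_on_def)
  have finX: "finite ?X" unfolding X[symmetric] using F by simp
  have "(\<Sum>c\<in>F. \<Sum>d\<in>dirs. \<omega> (c - d * ((1 + \<i>) / 2), d)) = (\<Sum>u\<in>F \<times> dirs. \<omega> (?h u))"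
    by (simp add: sum.cartesian_product case_prod_unfold)
  also have "\<dots> = sum \<omega> ?X" unfolding X[symmetric] using sum.reindex[OF inj, of \<omega>] by simp
  also have "\<dots> = sum \<omega> ?Y + sum \<omega> (?X - ?Y)"
    by (subst add.commute) (rule sum.subset_diff, use finX in auto)
  also have "sum \<omega> ?Y = 0"
  proof -
    have "bij_betw rev_edge ?Y ?Y"
      by (rule bij_betwI[of _ _ _ rev_edge]) auto
    then have "sum \<omega> ?Y = (\<Sum>e\<in>?Y. \<omega> (rev_edge e))" by (rule sum.reindex_bij_betw[symmetric])
    then show ?thesis by (simp add: anti sum_negf)
  qed
  also have "?X - ?Y = {e. snd e \<in> dirs \<and> left e \<in> F \<and> right e \<notin> F}" by auto
  finally show ?thesis by simp
qed

text \<open>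
  The discrete content of the Jordan curve theorem: \<open>F\<close> consists of the cells inside the closed walk,
  and \<open>ccw\<close> tells on which side of the walk they lie.
\<close>

definition encloses :: "bool \<Rightarrow> (nat \<Rightarrow> complex) \<Rightarrow> nat \<Rightarrow> complex set \<Rightarrow> bool" where
  "encloses ccw h n F \<longleftrightarrow> finite F \<and> F \<subseteq> cells \<and>
    (\<forall>k<n. (left (edge h k) \<in> F \<longleftrightarrow> ccw) \<and> (right (edge h k) \<in> F \<longleftrightarrow> \<not> ccw)) \<and>
    (\<forall>e. fst e \<in> gauss \<longrightarrow> snd e \<in> dirs \<longrightarrow> (\<forall>k<n. \<not> same_edge (edge h k) e) \<longrightarrow>
      (left e \<in> F \<longleftrightarrow> right e \<in> F))"

text \<open>
  Up to orientation, the edges with a cell of \<open>F\<close> on the left only are those of the walk, each once.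
\<close>

lemma loop_stokes:
  fixes \<omega> :: "edge \<Rightarrow> real"
  assumes enc: "encloses ccw h n F" and h: "\<And>k. h k \<in> dirs" and inj: "edge_inj h {..<n}"
    and anti: "\<And>e. \<omega> (rev_edge e) = - \<omega> e"
  shows "(\<Sum>c\<in>F. \<Sum>d\<in>dirs. \<omega> (c - d * ((1 + \<i>) / 2), d)) =
    (if ccw then 1 else - 1) * (\<Sum>k<n. \<omega> (edge h k))"
proof -
  let ?e = "\<lambda>k. if ccw then edge h k else rev_edge (edge h k)"
  have B: "{e. snd e \<in> dirs \<and> left e \<in> F \<and> right e \<notin> F} = ?e ` {..<n}" (is "?B = _")
  proof
    show "?e ` {..<n} \<subseteq> ?B"
    proof
      fix e assume "e \<in> ?e ` {..<n}"
      then obtain k where k: "k < n" "e = ?e k" by blast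
      have "snd (edge h k) \<in> dirs" "snd (rev_edge (edge h k)) \<in> dirs"
        using h by (simp_all add: edge_def rev_edge_def)
      moreover have "left (edge h k) \<in> F \<longleftrightarrow> ccw" "right (edge h k) \<in> F \<longleftrightarrow> \<not> ccw"
        using enc k(1) by (simp_all add: encloses_def)
      ultimately show "e \<in> ?B" unfolding k(2) by simp
    qed
    show "?B \<subseteq> ?e ` {..<n}"
    proof
      fix e assume e: "e \<in> ?B"
      have "fst e = left e - snd e * ((1 + \<i>) / 2)" by (simp add: left_def)
      moreover have "left e \<in> cells" using e enc by (auto simp: encloses_def)
      ultimately have "fst e \<in> gauss" using e cells_minus_half_diagonal by auto
      then obtain k where k: "k < n" "same_edge (edge h k) e"
        using e enc unfolding encloses_def by blast
      have "left (edge h k) \<in> F \<longleftrightarrow> ccw" "right (edge h k) \<in> F \<longleftrightarrow> \<not> ccw"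
        using enc k(1) by (simp_all add: encloses_def)
      then have "e = ?e k" using k(2) e by (auto simp: same_edge_def)
      then show "e \<in> ?e ` {..<n}" using k(1) by blast
    qed
  qed
  have inj': "inj_on ?e {..<n}"
  proof (rule inj_onI)
    fix j k assume *: "j \<in> {..<n}" "k \<in> {..<n}" "?e j = ?e k"
    then have "edge h j = edge h k" by (cases ccw) (simp_all, metis rev_rev_edge)
    then show "j = k" using inj *(1,2) by (auto simp: edge_inj_def same_edge_def)
  qed
  have "sum \<omega> ?B = (\<Sum>k<n. \<omega> (?e k))" unfolding B sum.reindex[OF inj'] comp_def by (rule refl)
  also have "\<dots> = (if ccw then 1 else - 1) * (\<Sum>k<n. \<omega> (edge h k))"
    by (simp add: anti sum_negf)
  finally show ?thesis using cells_stokes[of F \<omega>] enc anti by (simp add: encloses_def)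
qed

text \<open>
  Two of the four sides of the square run towards their even end point, so their arms are traversed
  backwards and contribute with a minus sign.
\<close>

lemma sum_refine_loop:
  fixes \<omega> :: "edge \<Rightarrow> real"
  assumes anti: "\<And>e. \<omega> (rev_edge e) = - \<omega> e"
  shows "(\<Sum>k<4 * m. \<omega> (edge (refine g m (\<lambda>t. \<i> ^ t)) k)) =
    (\<Sum>i<m. \<omega> (arm g m 0 1 i)) - (\<Sum>i<m. \<omega> (arm g m (1 + \<i>) (- \<i>) i)) +
    (\<Sum>i<m. \<omega> (arm g m (1 + \<i>) (- 1) i)) - (\<Sum>i<m. \<omega> (arm g m 0 \<i> i))"
proof -
  let ?q = "\<lambda>t. \<i> ^ t" and ?E = "edge (refine g m (\<lambda>t. \<i> ^ t))"
  have side: "(\<Sum>k\<in>{t * m..<t * m + m}. \<omega> (?E k)) =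
    (if even t then 1 else - 1) * (\<Sum>i<m. \<omega> (arm g m (base ?q t) (aim ?q t) i))" for t
  proof -
    have "(\<Sum>k\<in>{t * m..<t * m + m}. \<omega> (?E k)) = (\<Sum>i<m. \<omega> (?E (m * t + i)))"
      using sum.shift_bounds_nat_ivl[of "\<lambda>k. \<omega> (?E k)" 0 "t * m" m]
      by (simp add: lessThan_atLeast0 algebra_simps)
    also have "\<dots> = (if even t then 1 else - 1) * (\<Sum>i<m. \<omega> (arm g m (base ?q t) (aim ?q t) i))"
    proof (cases "even t")
      case True then show ?thesis by (simp add: edge_refine)
    next
      case False
      then have "(\<Sum>i<m. \<omega> (?E (m * t + i))) =
          - (\<Sum>i<m. \<omega> (arm g m (base ?q t) (aim ?q t) (m - Suc i)))"
        by (simp add: edge_refine anti sum_negf)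
      also have "\<dots> = - (\<Sum>i<m. \<omega> (arm g m (base ?q t) (aim ?q t) i))"
        using sum.nat_diff_reindex[of "\<lambda>i. \<omega> (arm g m (base ?q t) (aim ?q t) i)" m] by simp
      finally show ?thesis using False by simp
    qed
    finally show ?thesis .
  qed
  have "(\<Sum>k<4 * m. \<omega> (?E k)) = (\<Sum>t<4. \<Sum>k\<in>{t * m..<t * m + m}. \<omega> (?E k))"
    by (rule sum.nat_group[symmetric])
  also have "\<dots> = (\<Sum>t\<in>{0, 1, 2, 3}. (if even t then 1 else - 1) * (\<Sum>i<m. \<omega> (arm g m (base ?q t) (aim ?q t) i)))"
    unfolding side by (rule sum.cong) auto
  also have "\<dots> = (\<Sum>i<m. \<omega> (arm g m (base ?q 0) (aim ?q 0) i))
     - (\<Sum>i<m. \<omega> (arm g m (base ?q 1) (aim ?q 1) i))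
     + (\<Sum>i<m. \<omega> (arm g m (base ?q 2) (aim ?q 2) i))
     - (\<Sum>i<m. \<omega> (arm g m (base ?q 3) (aim ?q 3) i))"
    by simp
  finally show ?thesis unfolding square_sides .
qed

lemma dirs_cnj: "d \<in> dirs \<Longrightarrow> cnj d * d = 1"
  by (auto simp: dirs_def)

lemma square_turning: "turning (\<lambda>t. \<i> ^ t)"
  unfolding turning_def
proof (intro allI conjI)
  show "\<i> ^ k \<in> dirs" for k by (induction k) (auto intro: dirs_mult)
qed simp

text \<open>
  The form \<open>\<omega>\<close> is twice the area form, so it sums to \<open>2\<close> around each cell. The sum along an arm is
  that along its chord plus a quantity \<open>A\<close> that depends on \<open>g\<close> only. As two arms of the loop are
  traversed forwards and two backwards, \<open>A\<close> cancels, and the square on the chord remains, which is run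
  through counterclockwise. A negative orientation is impossible as this area is not negative.
\<close>

lemma enclosed_area:
  assumes enc: "encloses ccw (refine g m (\<lambda>t. \<i> ^ t)) (4 * m) F" and m: "m > 0"
    and g: "turning g" and inj: "edge_inj (refine g m (\<lambda>t. \<i> ^ t)) {..<4 * m}"
  shows "ccw" "real (card F) = (cmod (pos g m))\<^sup>2" "card F > 0"
proof -
  let ?h = "refine g m (\<lambda>t. \<i> ^ t)" and ?z = "pos g m"
  define \<omega> where "\<omega> e = Im (cnj (fst e) * snd e)" for e :: edge
  have anti: "\<omega> (rev_edge e) = - \<omega> e" for e
    by (simp add: \<omega>_def rev_edge_def algebra_simps)
  have h: "?h k \<in> dirs" for k
    using refine_turning[OF g square_turning m] by (simp add: turning_def)
  have cell: "(\<Sum>d\<in>dirs. \<omega> (c - d * ((1 + \<i>) / 2), d)) = 2" for c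
    by (simp add: \<omega>_def sum_dirs algebra_simps)
  \<comment> \<open>The deviation of an arm from its chord; only its independence of the arm matters.\<close>
  define A where "A = (\<Sum>i<m. Im (cnj (pos g i) * g i))"
  have side: "(\<Sum>i<m. \<omega> (arm g m v d i)) = Im (cnj (?z * v) * d * ?z) + A" if "d \<in> dirs" for v d
  proof -
    have "\<omega> (arm g m v d i) = Im (cnj (?z * v) * d * g i) + Im (cnj (pos g i) * g i)" for i
    proof -
      have "cnj (?z * v + d * pos g i) * (d * g i)
          = cnj (?z * v) * d * g i + (cnj d * d) * (cnj (pos g i) * g i)"
        by (simp add: algebra_simps)
      then show ?thesis using dirs_cnj[OF that] by (simp add: \<omega>_def arm_def)
    qed
    then have "(\<Sum>i<m. \<omega> (arm g m v d i)) = Im (\<Sum>i<m. cnj (?z * v) * d * g i) + A"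
      by (simp add: A_def sum.distrib)
    then show ?thesis by (simp add: pos_def sum_distrib_left)
  qed
  have z2: "(cmod ?z)\<^sup>2 = Re ?z * Re ?z + Im ?z * Im ?z"
    using cmod_power2[of ?z] by (simp only: power2_eq_square)
  have total: "(\<Sum>k<4 * m. \<omega> (edge ?h k)) = 2 * (cmod ?z)\<^sup>2"
    unfolding sum_refine_loop[of \<omega>, OF anti]
    by (simp only: side dirs_simps) (simp add: z2 algebra_simps)
  have area: "2 * real (card F) = (if ccw then 1 else - 1) * (2 * (cmod ?z)\<^sup>2)"
    using loop_stokes[of ccw ?h "4 * m" F \<omega>, OF enc h inj anti] unfolding cell total by simp
  have "left (edge ?h 0) \<in> F \<or> right (edge ?h 0) \<in> F" "finite F"
    using enc m by (auto simp: encloses_def)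
  then show pos: "card F > 0" by (auto simp: card_gt_0_iff)
  show ccw
  proof (rule ccontr)
    assume "\<not> ccw"
    with area have "2 * real (card F) = - (2 * (cmod ?z)\<^sup>2)" by simp
    moreover have "(cmod ?z)\<^sup>2 \<ge> 0" by simp
    ultimately show False using pos by simp
  qed
  with area show "real (card F) = (cmod (pos g m))\<^sup>2" by simp
qed

text \<open>
  The number of translates of \<open>F\<close> by multiples of \<open>\<beta>\<close> that contain \<open>p\<close>.
\<close>


section \<open>The tiling by translates of the enclosed cells\<close>

definition cover :: "complex \<Rightarrow> complex set \<Rightarrow> complex \<Rightarrow> real" where
  "cover \<beta> F p = (\<Sum>q\<in>F. lat \<beta> (p - q))"

lemma cover_ge:
  assumes "finite F" "G \<subseteq> F" "\<And>q. q \<in> G \<Longrightarrow> \<exists>a\<in>gauss. p - q = \<beta> * a"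
  shows "cover \<beta> F p \<ge> card G"
proof -
  have "real (card G) = (\<Sum>q\<in>G. lat \<beta> (p - q))"
    using assms(3) by (simp add: lat_def)
  also have "\<dots> \<le> cover \<beta> F p"
    unfolding cover_def by (rule sum_mono2) (use assms in \<open>auto simp: lat_def\<close>)
  finally show ?thesis .
qed

text \<open>
  A cell centre is a Gaussian integer plus \<open>(1 + \<i>) / 2\<close>, and the quarter turn about the origin maps
  this offset to itself up to the Gaussian integer \<open>1\<close>.
\<close>

lemma cells_rotate:
  assumes "c \<in> cells"
  shows "\<i> * c \<in> cells"
proof -
  have "\<i> * (c - (1 + \<i>) / 2) - 1 \<in> gauss"
    by (rule gauss_diff[OF gauss_mult]) (use assms in \<open>simp_all add: cells_def\<close>)
  moreover have "\<i> * (c - (1 + \<i>) / 2) - 1 = \<i> * c - (1 + \<i>) / 2" by (simp add: field_simps)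
  ultimately show ?thesis by (simp only: cells_def mem_Collect_eq)
qed

lemma cells_diff:
  assumes "c \<in> cells" "c' \<in> cells"
  shows "c - c' \<in> gauss"
proof -
  have "(c - (1 + \<i>) / 2) - (c' - (1 + \<i>) / 2) \<in> gauss"
    by (rule gauss_diff) (use assms in \<open>simp_all only: cells_def mem_Collect_eq\<close>)
  then show ?thesis by simp
qed

lemma cells_add:
  assumes "c \<in> cells" "a \<in> gauss"
  shows "c + a \<in> cells"
proof -
  have "(c - (1 + \<i>) / 2) + a \<in> gauss"
    by (rule gauss_add) (use assms in \<open>simp_all only: cells_def mem_Collect_eq\<close>)
  then show ?thesis by (simp add: cells_def algebra_simps)
qed

definition shift :: "complex \<Rightarrow> edge \<Rightarrow> edge" where
  "shift a e = (fst e + a, snd e)"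

lemma left_shift [simp]: "left (shift a e) = left e + a"
  and right_shift [simp]: "right (shift a e) = right e + a"
  by (simp_all add: shift_def left_def right_def rev_edge_def)

text \<open>
  Modulo the multiples of \<open>1 + \<i>\<close>, that is up to parity, the position of a walk is determined by the
  number of steps. Matching the direction as well, every edge of the walk is the translate by an even
  point of a side of the unit square.
\<close>

lemma turning_quarter:
  assumes f: "turning f" "f 0 = 1"
  obtains t' w where "t' < 4" "even t' = even t" "f t = \<i> ^ t'" "w \<in> gauss"
    "pos f t = pos (\<lambda>t. \<i> ^ t) t' + (1 + \<i>) * w"
proof -
  have "\<exists>t'<4. \<exists>w\<in>gauss. even t' = even t \<and> f t = \<i> ^ t' \<and>
    pos f t = pos (\<lambda>t. \<i> ^ t) t' + (1 + \<i>) * w"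
  proof (induction t)
    case 0
    show ?case using f(2) by (intro exI[of _ 0] conjI bexI[of _ 0]) auto
  next
    case (Suc t)
    let ?V = "pos (\<lambda>t. \<i> ^ t)"
    have up: "\<i> * \<i> ^ x = \<i> ^ (Suc x mod 4) \<and> ?V x + \<i> ^ x = ?V (Suc x mod 4) \<and> (even (Suc x mod 4) \<longleftrightarrow> odd x)"
      and down: "- \<i> * \<i> ^ x = \<i> ^ ((x + 3) mod 4) \<and>
        ?V x + \<i> ^ x = ?V ((x + 3) mod 4) + (1 + \<i>) * \<i> ^ ((x + 3) mod 4) \<and>
        (even ((x + 3) mod 4) \<longleftrightarrow> odd x)" if "x < 4" for x
    proof -
      have c: "x = 0 \<or> x = 1 \<or> x = 2 \<or> x = 3" using that by linarith
      show "\<i> * \<i> ^ x = \<i> ^ (Suc x mod 4) \<and> ?V x + \<i> ^ x = ?V (Suc x mod 4) \<and> (even (Suc x mod 4) \<longleftrightarrow> odd x)"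
        using c by (elim disjE) (simp_all add: pos_square power3_eq_cube)
      show "- \<i> * \<i> ^ x = \<i> ^ ((x + 3) mod 4) \<and>
        ?V x + \<i> ^ x = ?V ((x + 3) mod 4) + (1 + \<i>) * \<i> ^ ((x + 3) mod 4) \<and>
        (even ((x + 3) mod 4) \<longleftrightarrow> odd x)"
        using c by (elim disjE) (simp_all add: pos_square power3_eq_cube algebra_simps)
    qed
    obtain t' w where IH: "t' < 4" "w \<in> gauss" "even t' = even t" "f t = \<i> ^ t'"
      "pos f t = ?V t' + (1 + \<i>) * w" using Suc by blast
    from f(1) consider "f (Suc t) = \<i> * f t" | "f (Suc t) = - \<i> * f t"
      unfolding turning_def by blast
    then show ?case
    proof cases
      case 1
      show ?thesis
        by (rule exI[of _ "Suc t' mod 4"], intro conjI bexI[of _ w])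
          (use up[OF IH(1)] IH 1 in \<open>simp_all add: add.assoc[symmetric]\<close>)
    next
      case 2
      show ?thesis
        \<comment> \<open>A right turn goes back by one side of the square, which costs a translation by
          \<open>1 + \<i>\<close> times that side.\<close>
        by (rule exI[of _ "(t' + 3) mod 4"], intro conjI bexI[of _ "w + \<i> ^ ((t' + 3) mod 4)"])
          (use down[OF IH(1)] IH 2 square_turning in \<open>auto simp: algebra_simps turning_def\<close>)
    qed
  qed
  then show thesis using that by blast
qed

text \<open>
  In what follows \<open>cover \<beta> F p\<close> counts the translates of \<open>F\<close> at the cell \<open>p\<close>, and \<open>cover \<beta> F (\<i> p)\<close>
  those of \<open>-\<i> F\<close>, because the lattice is invariant under quarter turns. The set \<open>-\<i> F\<close> is enclosed by
  the image of the unit square on the other side of the edge from \<open>0\<close> to \<open>1\<close>.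
\<close>

locale simple_loop =
  fixes g :: "nat \<Rightarrow> complex" and m :: nat and F :: "complex set"
  assumes m_pos: "m > 0" and g_turning: "turning g"
    and inj: "edge_inj (refine g m (\<lambda>t. \<i> ^ t)) {..<4 * m}"
    and enc: "encloses True (refine g m (\<lambda>t. \<i> ^ t)) (4 * m) F"
begin

abbreviation "h \<equiv> refine g m (\<lambda>t. \<i> ^ t)"
abbreviation "z \<equiv> pos g m"
definition "\<beta> = (1 + \<i>) * z"

lemma h_dirs: "h k \<in> dirs"
  using refine_turning[OF g_turning square_turning m_pos] by (simp add: turning_def)

lemma g_dirs: "g k \<in> dirs"
  using g_turning by (simp add: turning_def)

lemma z_gauss: "z \<in> gauss"
  using g_dirs by (simp add: pos_def gauss_sum)

lemma \<beta>_gauss: "\<beta> \<in> gauss"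
  using z_gauss by (simp add: \<beta>_def)

lemma card_F: "card F > 0" "real (card F) = (cmod z)\<^sup>2"
  using enclosed_area[OF enc m_pos g_turning inj] by simp_all

lemma \<beta>_norm: "\<beta> * cnj \<beta> = of_nat (2 * card F)"
proof -
  have "\<beta> * cnj \<beta> = ((1 + \<i>) * (1 - \<i>)) * (z * cnj z)"
    by (simp add: \<beta>_def)
  also have "(1 + \<i>) * (1 - \<i>) = 2" by (simp add: algebra_simps)
  also have "z * cnj z = of_real ((cmod z)\<^sup>2)" by (rule complex_norm_square[symmetric])
  finally show ?thesis using card_F(2) by (metis of_nat_mult of_nat_numeral of_real_of_nat_eq)
qed

lemma \<beta>_nonzero: "\<beta> \<noteq> 0"
  using \<beta>_norm card_F(1) by auto

text \<open>
  A form on edges whose sum around a cell \<open>c\<close> is the increment of the indicator of \<open>c + \<Lambda>\<close> between \<open>p\<close>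
  and its neighbour \<open>p + \<i> f\<close> (lemma \<open>flux_cell\<close>). By Stokes, its sum along the loop is the increment
  of \<open>cover\<close>.
\<close>

definition flux :: "complex \<Rightarrow> complex \<Rightarrow> edge \<Rightarrow> real" where
  "flux p f e = of_bool (snd e = f) * lat \<beta> (p - right e) - of_bool (snd e = - f) * lat \<beta> (p - left e)"

lemma flux_rev_edge: "flux p f (rev_edge e) = - flux p f e"
proof -
  have "- snd e = f \<longleftrightarrow> snd e = - f" by (metis minus_minus)
  then show ?thesis by (simp add: flux_def)
qed

lemma flux_cell:
  assumes "f \<in> dirs"
  shows "(\<Sum>d\<in>dirs. flux p f (c - d * ((1 + \<i>) / 2), d)) = lat \<beta> (p + \<i> * f - c) - lat \<beta> (p - c)"
proof -
  have flux: "flux p f (c - d * ((1 + \<i>) / 2), d) =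
      of_bool (d = f) * lat \<beta> (p + \<i> * d - c) - of_bool (d = - f) * lat \<beta> (p - c)" for d
  proof -
    have l: "left (c - d * ((1 + \<i>) / 2), d) = c" by (simp add: left_def)
    have r: "right (c - d * ((1 + \<i>) / 2), d) = c - \<i> * d" by (simp add: right_def field_simps)
    have e: "p - (c - \<i> * d) = p + \<i> * d - c" by simp
    show ?thesis by (simp only: flux_def l r e snd_conv)
  qed
  have pick: "(\<Sum>d\<in>dirs. of_bool (d = a) * A d) = A a" if "a \<in> dirs" for a and A :: "complex \<Rightarrow> real"
  proof -
    have "dirs \<inter> {d. d = a} = {a}" using that by auto
    then show ?thesis using sum_of_bool_mult_eq[of dirs "\<lambda>d. d = a" A] by simp
  qed
  have "- f \<in> dirs" using assms by simp
  from pick[OF this, of "\<lambda>_. lat \<beta> (p - c)"]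
  show ?thesis unfolding flux sum_subtractf pick[OF assms] by simp
qed

lemma cover_diff:
  assumes "f \<in> dirs"
  shows "cover \<beta> F (p + \<i> * f) - cover \<beta> F p = (\<Sum>k<4 * m. flux p f (edge h k))"
  using loop_stokes[of True h "4 * m" F "flux p f", OF enc h_dirs inj flux_rev_edge]
  unfolding flux_cell[OF assms] cover_def sum_subtractf by (simp only: if_True mult_1)

lemma flux_shift:
  assumes "a \<in> gauss"
  shows "flux p f (q + \<beta> * a, d) = flux p f (q, d)"
  using lat_add[of "- a" \<beta> "p - right (q, d)"] lat_add[of "- a" \<beta> "p - left (q, d)"] assms
  by (simp add: flux_def left_def right_def algebra_simps)

lemma flux_rotate: "flux (\<i> * p) (\<i> * f) (\<i> * q, \<i> * d) = flux p f (q, d)"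
proof -
  have 1: "\<i> * p - right (\<i> * q, \<i> * d) = \<i> * (p - right (q, d))"
    "\<i> * p - left (\<i> * q, \<i> * d) = \<i> * (p - left (q, d))"
    by (simp_all add: left_def right_def algebra_simps)
  have 2: "\<i> * d = - (\<i> * f) \<longleftrightarrow> d = - f" by (metis complex_i_not_zero mult_cancel_left mult_minus_right)
  show ?thesis by (simp add: flux_def 1 2 lat_ii del: mult_minus_right)
qed

text \<open>
  The increment of \<open>cover\<close> is an alternating sum over the four arms \<open>T\<close> at the origin, since the flux
  does not see translations by the lattice. A quarter turn shifts these arms cyclically and thereby
  changes the sign of the alternating sum, so the two increments cancel.
\<close>

lemma cover_sum_invariant:
  assumes f: "f \<in> dirs"
  shows "cover \<beta> F (p + \<i> * f) + cover \<beta> F (\<i> * (p + \<i> * f)) = cover \<beta> F p + cover \<beta> F (\<i> * p)"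
proof -
  define T where "T p f d = (\<Sum>i<m. flux p f (arm g m 0 d i))" for p f d
  have shift: "flux p f (arm g m (1 + \<i>) d i) = flux p f (arm g m 0 d i)" for p f d i
    using flux_shift[of 1 p f "d * pos g i" "d * g i"] by (simp add: arm_def \<beta>_def algebra_simps)
  have sum: "(\<Sum>k<4 * m. flux p f (edge h k)) = T p f 1 - T p f (- \<i>) + T p f (- 1) - T p f \<i>" for p f
    unfolding sum_refine_loop[of "flux p f", OF flux_rev_edge] T_def shift ..
  \<comment> \<open>The quarter turn maps the arm in direction \<open>d\<close> to that in direction \<open>\<i> d\<close>.\<close>
  have rot: "T (\<i> * p) (\<i> * f) (\<i> * d) = T p f d" for d
    unfolding T_def arm_def using flux_rotate[of p f "d * pos g i" "d * g i" for i]
    by (simp add: mult.assoc)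
  have "T (\<i> * p) (\<i> * f) 1 = T p f (- \<i>)" "T (\<i> * p) (\<i> * f) (- \<i>) = T p f (- 1)"
    "T (\<i> * p) (\<i> * f) (- 1) = T p f \<i>" "T (\<i> * p) (\<i> * f) \<i> = T p f 1"
    using rot[of "- \<i>"] rot[of "-1"] rot[of \<i>] rot[of 1] by simp_all
  moreover have e: "\<i> * (p + \<i> * f) = \<i> * p + \<i> * (\<i> * f)" by (rule distrib_left)
  ultimately show ?thesis
    using cover_diff[OF dirs_mult[OF dirs_simps(2) f], of "\<i> * p"] cover_diff[OF f, of p]
    unfolding sum e by linarith
qed

lemma sum_cover:
  assumes "\<And>q. q \<in> F \<Longrightarrow> b - q \<in> gauss"
  shows "(\<Sum>u\<in>{..<2 * card F} \<times> {..<2 * card F}. cover \<beta> F (b + grid u)) = 2 * (real (card F))\<^sup>2"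
proof -
  let ?n = "2 * card F"
  have "(\<Sum>u\<in>{..<?n} \<times> {..<?n}. cover \<beta> F (b + grid u)) = (\<Sum>q\<in>F. box_sum ?n (lat \<beta>) (b - q))"
    unfolding cover_def box_sum_def by (subst sum.swap) (simp add: algebra_simps)
  also have "\<dots> = (\<Sum>q\<in>F. real ?n)"
    by (rule sum.cong[OF refl])
      (rule box_sum_lat[OF \<beta>_norm \<beta>_gauss], use card_F(1) assms in auto)
  finally show ?thesis by (simp add: power2_eq_square)
qed

text \<open>
  The sum is the same for all cells, so it equals its average over a box of side \<open>n = 2 (card F)\<close>. Each
  element of \<open>F\<close> has exactly \<open>n\<close> lattice translates in a box (lemma \<open>box_sum_lat\<close>), and it counts twice, once for \<open>F\<close> and once for \<open>-\<i> F\<close>. The average is therefore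
  \<open>2 (card F) n / n\<^sup>2 = 1\<close>.
\<close>

lemma cover_once:
  assumes p: "p \<in> cells"
  shows "cover \<beta> F p + cover \<beta> F (\<i> * p) = 1"
proof -
  let ?N = "\<lambda>p. cover \<beta> F p + cover \<beta> F (\<i> * p)"
  let ?n = "2 * card F"
  let ?B = "{..<?n} \<times> {..<?n}"
  have const: "?N (p + a) = ?N p" if "a \<in> gauss" for a p
  proof (rule periodic_gauss[OF _ _ that])
    show "?N (b + 1) = ?N b" for b using cover_sum_invariant[of "- \<i>" b] by simp
    show "?N (b + \<i>) = ?N b" for b using cover_sum_invariant[of 1 b] by simp
  qed
  have Fc: "q \<in> cells" if "q \<in> F" for q using enc that by (auto simp: encloses_def)
  have "(\<Sum>u\<in>?B. ?N (p + grid u)) = 2 * (real (card F))\<^sup>2 + 2 * (real (card F))\<^sup>2"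
  proof -
    have "cover \<beta> F (\<i> * (p + grid u)) = (\<Sum>q\<in>F. lat \<beta> (p + \<i> * q + grid u))" for u
      unfolding cover_def
    proof (rule sum.cong[OF refl])
      fix q
      have "\<i> * (p + grid u) - q = \<i> * (p + \<i> * q + grid u)" by (simp add: algebra_simps)
      then show "lat \<beta> (\<i> * (p + grid u) - q) = lat \<beta> (p + \<i> * q + grid u)"
        by (simp only: lat_ii)
    qed
    then have "(\<Sum>u\<in>?B. cover \<beta> F (\<i> * (p + grid u))) = (\<Sum>q\<in>F. box_sum ?n (lat \<beta>) (p + \<i> * q))"
      unfolding box_sum_def by (subst sum.swap) simp
    also have "\<dots> = (\<Sum>q\<in>F. real ?n)"
    proof (rule sum.cong[OF refl])
      fix q assume q: "q \<in> F"
      have "p + \<i> * q = p - \<i> * (\<i> * (\<i> * q))" by simp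
      then have "p + \<i> * q \<in> gauss"
        using p Fc[OF q] by (simp only: cells_diff cells_rotate)
      then show "box_sum ?n (lat \<beta>) (p + \<i> * q) = real ?n"
        using card_F(1) by (intro box_sum_lat[OF \<beta>_norm \<beta>_gauss]) auto
    qed
    finally have "(\<Sum>u\<in>?B. cover \<beta> F (\<i> * (p + grid u))) = 2 * (real (card F))\<^sup>2"
      by (simp add: power2_eq_square)
    then show ?thesis
      unfolding sum.distrib using sum_cover[of p] p Fc by (simp add: cells_diff)
  qed
  moreover have "(\<Sum>u\<in>?B. ?N (p + grid u)) = (\<Sum>u\<in>?B. ?N p)"
    by (rule sum.cong[OF refl]) (simp only: const grid_gauss)
  moreover have "(\<Sum>u\<in>?B. ?N p) = 4 * (real (card F))\<^sup>2 * ?N p"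
    by (simp add: power2_eq_square)
  ultimately have "4 * (real (card F))\<^sup>2 * ?N p = 4 * (real (card F))\<^sup>2 * 1" by linarith
  then show ?thesis using card_F(1) unfolding mult_cancel_left by simp
qed

definition touches :: "complex \<Rightarrow> bool" where
  "touches x \<longleftrightarrow> (\<exists>a\<in>gauss. x + \<beta> * a \<in> F)"

lemma touches_shift: "a \<in> gauss \<Longrightarrow> touches (x + \<beta> * a) \<longleftrightarrow> touches x"
proof -
  have imp: "touches (x + \<beta> * a)" if a: "a \<in> gauss" and x: "touches x" for x a
  proof -
    obtain b where "b \<in> gauss" "x + \<beta> * b \<in> F" using x unfolding touches_def by blast
    then show ?thesis unfolding touches_def
      using a by (intro bexI[of _ "b - a"]) (auto simp: algebra_simps)
  qed
  assume "a \<in> gauss"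
  then show ?thesis using imp[of a x] imp[of "- a" "x + \<beta> * a"] by auto
qed

lemma cover_of_touches:
  assumes "touches x"
  shows "cover \<beta> F x \<ge> 1"
proof -
  obtain b where b: "b \<in> gauss" "x + \<beta> * b \<in> F" using assms unfolding touches_def by blast
  have "cover \<beta> F x \<ge> card {x + \<beta> * b}"
    by (rule cover_ge) (use b enc in \<open>auto simp: encloses_def intro!: bexI[of _ "- b"]\<close>)
  then show ?thesis by simp
qed

lemma arm_base_shift: "arm g m (v + (1 + \<i>) * a) d i = shift (\<beta> * a) (arm g m v d i)"
  by (simp add: arm_def shift_def \<beta>_def algebra_simps)

lemma arm_touches:
  assumes i: "i < m"
  shows "touches (left (arm g m 0 1 i))" "touches (left (arm g m 0 (- 1) i))"
    "touches (right (arm g m 0 \<i> i))" "touches (right (arm g m 0 (- \<i>) i))"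
proof -
  have F: "left (edge h k) \<in> F" if "k < 4 * m" for k
    using enc that by (auto simp: encloses_def)
  have t: "touches x" if "x \<in> F" for x
    unfolding touches_def using that by (intro bexI[of _ 0]) auto
  have e: "touches (left (edge h (m * t + i)))" if "t < 4" "i < m" for t i
  proof -
    have "m * t + i < m * Suc t" using that by simp
    also have "\<dots> \<le> m * 4" using that by (intro mult_le_mono2) simp
    finally show ?thesis by (intro t F) simp
  qed
  have s: "arm g m (1 + \<i>) d i = shift (\<beta> * 1) (arm g m 0 d i)" for d
    using arm_base_shift[of 0 1 d i] by simp
  have j: "m - 1 - i < m" "m - 1 - (m - 1 - i) = i" using i by auto
  note E = edge_refine[of _ m g "\<lambda>t. \<i> ^ t"]
  show "touches (left (arm g m 0 1 i))"
    using e[of 0 i] E[of i 0] i unfolding square_sides by simp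
  show "touches (left (arm g m 0 (- 1) i))"
    using e[of 2 i] E[of i 2] i touches_shift[of 1] unfolding square_sides by (simp add: s)
  show "touches (right (arm g m 0 \<i> i))"
    using e[of 3 "m - 1 - i"] E[of "m - 1 - i" 3] j unfolding square_sides by simp
  show "touches (right (arm g m 0 (- \<i>) i))"
    using e[of 1 "m - 1 - i"] E[of "m - 1 - i" 1] j touches_shift[of 1] unfolding square_sides by (simp add: s)
qed

text \<open>
  The cell to the right of an edge of the loop belongs to a translate of \<open>-\<i> F\<close>. Indeed, the quarter
  turn maps the arm of a side with base \<open>0\<close>, up to the lattice, to the arm in the next direction, and
  that one is traversed by the loop the other way round.
\<close>

lemma touches_right:
  assumes k: "k < 4 * m"
  shows "touches (\<i> * right (edge h k))"
proof -
  obtain i where i: "i < m" "k = m * (k div m) + (if even (k div m) then i else m - 1 - i)"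
    using refine_edge_arm[OF m_pos] by metis
  define t where "t = k div m"
  have t: "t < 4" using k by (simp add: t_def less_mult_imp_div_less)
  have "edge h k = (if even t then arm g m (base (\<lambda>t. \<i> ^ t) t) (aim (\<lambda>t. \<i> ^ t) t) i
      else rev_edge (arm g m (base (\<lambda>t. \<i> ^ t) t) (aim (\<lambda>t. \<i> ^ t) t) i))"
  proof (cases "even t")
    case True
    then have "k = m * t + i" using i(2) by (simp add: t_def)
    then show ?thesis using edge_refine[OF i(1), of g "\<lambda>t. \<i> ^ t" t] True by simp
  next
    case False
    then have "k = m * t + (m - 1 - i)" using i(2) by (simp add: t_def)
    then show ?thesis using edge_refine[of "m - 1 - i" m g "\<lambda>t. \<i> ^ t" t] False i(1) by simp
  qed
  note E = this
  have rot: "\<i> * left (arm g m 0 d i) = left (arm g m 0 (\<i> * d) i)"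
    "\<i> * right (arm g m 0 d i) = right (arm g m 0 (\<i> * d) i)" for d
    by (simp_all add: arm_def left_def right_def algebra_simps)
  have s: "arm g m (1 + \<i>) d i = shift (\<beta> * 1) (arm g m 0 d i)" for d
    using arm_base_shift[of 0 1 d i] by simp
  have ts: "touches (\<i> * (x + \<beta>)) \<longleftrightarrow> touches (\<i> * x)" for x
    using touches_shift[of \<i> "\<i> * x"] by (simp add: algebra_simps)
  consider "t = 0" | "t = 1" | "t = 2" | "t = 3" using t by linarith
  then show ?thesis
    using arm_touches[OF i(1)]
    by cases (simp_all add: E square_sides s ts rot del: One_nat_def)
qed

text \<open>
  If two translated edges agree with orientation, the cell on their left lies in both translates of
  \<open>F\<close>; if they agree with opposite orientation, the cell on the left of the first lies in a translate
  of \<open>F\<close> and in one of \<open>-\<i> F\<close>. Only the first is compatible with lemma \<open>cover_once\<close>, and only for the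
  same translate.
\<close>

lemma translates_disjoint:
  assumes k: "k < 4 * m" "k' < 4 * m" and w: "w \<in> gauss" "w' \<in> gauss"
    and same: "same_edge (shift (\<beta> * w) (edge h k)) (shift (\<beta> * w') (edge h k'))"
  shows "k = k' \<and> w = w'"
proof -
  have F: "left (edge h k) \<in> F" if "k < 4 * m" for k
    using enc that by (auto simp: encloses_def)
  define p where "p = left (edge h k) + \<beta> * w"
  have "left (edge h k) \<in> cells" using F[OF k(1)] enc by (auto simp: encloses_def)
  then have pc: "p \<in> cells" using w(1) \<beta>_gauss by (simp add: p_def cells_add)
  have one: "cover \<beta> F p + cover \<beta> F (\<i> * p) = 1" by (rule cover_once[OF pc])
  have nonneg: "cover \<beta> F x \<ge> 0" for x by (simp add: cover_def lat_def sum_nonneg)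
  from same consider (eq) "shift (\<beta> * w') (edge h k') = shift (\<beta> * w) (edge h k)" |
    (rev) "shift (\<beta> * w') (edge h k') = rev_edge (shift (\<beta> * w) (edge h k))"
    unfolding same_edge_def by blast
  then show ?thesis
  proof cases
    case eq
    let ?q = "left (edge h k)" and ?q' = "left (edge h k')"
    have p': "p = ?q' + \<beta> * w'" using arg_cong[OF eq, of left] by (simp add: p_def)
    have "cover \<beta> F p \<ge> card {?q, ?q'}"
    proof (rule cover_ge)
      have "p - ?q = \<beta> * w" by (simp add: p_def)
      moreover have "p - ?q' = \<beta> * w'" by (simp add: p')
      ultimately show "\<exists>a\<in>gauss. p - q = \<beta> * a" if "q \<in> {?q, ?q'}" for q
        using w that by blast
    qed (use F k enc in \<open>auto simp: encloses_def\<close>)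
    then have "card {?q, ?q'} < 2" using one nonneg[of "\<i> * p"] by linarith
    then have "?q = ?q'" by (cases "?q = ?q'") simp_all
    then have ww: "w = w'" using p' \<beta>_nonzero by (simp add: p_def)
    then have "edge h k = edge h k'" using eq by (simp add: shift_def prod_eq_iff)
    then have "k = k'" using inj k by (auto simp: edge_inj_def same_edge_def)
    with ww show ?thesis by simp
  next
    case rev
    have p': "p = right (edge h k') + \<beta> * w'" using arg_cong[OF rev, of right] by (simp add: p_def)
    have "touches (left (edge h k))"
      unfolding touches_def using F[OF k(1)] by (intro bexI[of _ 0]) auto
    then have 1: "cover \<beta> F p \<ge> 1"
      using touches_shift[OF w(1)] by (intro cover_of_touches) (simp add: p_def)
    have "\<i> * p = \<i> * right (edge h k') + \<beta> * (\<i> * w')" by (simp add: p' algebra_simps)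
    then have "touches (\<i> * p)"
      using touches_right[OF k(2)] touches_shift[of "\<i> * w'"] w(2) by simp
    then have "cover \<beta> F (\<i> * p) \<ge> 1" by (rule cover_of_touches)
    with 1 one show ?thesis by simp
  qed
qed

text \<open>
  The edges at the times \<open>j\<close> and \<open>k\<close> belong to the arms of the edges at the times \<open>j div m\<close> and
  \<open>k div m\<close>, which are translates of edges of the loop. Hence a coincidence descends to these earlier
  times.
\<close>

lemma curve_edge_inj:
  assumes c: "turning c" "c 0 = 1" "refine g m c = c" and m: "m \<ge> 2"
  shows "edge_inj c UNIV"
proof -
  let ?q = "\<lambda>t. \<i> ^ t"
  have rep: "\<exists>t'<4. \<exists>w\<in>gauss. c t = ?q t' \<and> pos c t = pos ?q t' + (1 + \<i>) * w \<and>
      (\<forall>i<m. edge c (m * t + i) = shift (\<beta> * w) (edge h (m * t' + i)))" for t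
  proof -
    obtain t' w where t: "t' < 4" "even t' = even t" "c t = \<i> ^ t'" "w \<in> gauss"
      "pos c t = pos ?q t' + (1 + \<i>) * w" by (rule turning_quarter[OF c(1,2)])
    have b: "block g m t = block g m t'" using t(2) by (simp add: block_def[abs_def])
    have "edge c (m * t + i) = shift (\<beta> * w) (edge h (m * t' + i))" if "i < m" for i
    proof -
      have "edge c (m * t + i) = edge (refine g m c) (m * t + i)" by (simp only: c(3))
      also have "\<dots> = shift (\<beta> * w) (edge h (m * t' + i))"
        unfolding edge_def pos_refine[OF less_imp_le[OF that]] refine_nth[OF that] b
        by (simp add: shift_def \<beta>_def t(3,5) algebra_simps)
      finally show ?thesis .
    qed
    then show ?thesis using t by blast
  qed
  have "j = k" if "same_edge (edge c j) (edge c k)" for j k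
    using that
  proof (induction "j + k" arbitrary: j k rule: less_induct)
    case less
    show ?case
    proof (cases "j + k = 0")
      case False
      define t i where "t = j div m" and "i = j mod m"
      define u l where "u = k div m" and "l = k mod m"
      have j: "j = m * t + i" by (simp only: t_def i_def mult_div_mod_eq)
      have k: "k = m * u + l" by (simp only: u_def l_def mult_div_mod_eq)
      have il: "i < m" "l < m" using m by (simp_all add: i_def l_def)
      obtain t' w where t': "t' < 4" "w \<in> gauss" "c t = ?q t'" "pos c t = pos ?q t' + (1 + \<i>) * w"
        "edge c j = shift (\<beta> * w) (edge h (m * t' + i))" using rep[of t] il j by blast
      obtain u' v where u': "u' < 4" "v \<in> gauss" "c u = ?q u'" "pos c u = pos ?q u' + (1 + \<i>) * v"
        "edge c k = shift (\<beta> * v) (edge h (m * u' + l))" using rep[of u] il k by blast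
      have bd: "m * x + y < 4 * m" if "x < 4" "y < m" for x y
      proof -
        have "m * x + y < m * Suc x" using that by simp
        also have "\<dots> \<le> m * 4" using that by (intro mult_le_mono2) simp
        finally show ?thesis by simp
      qed
      have eq: "m * t' + i = m * u' + l" "w = v"
        using translates_disjoint[OF bd[OF t'(1) il(1)] bd[OF u'(1) il(2)] t'(2) u'(2)]
          less.prems unfolding t'(5) u'(5) by blast+
      have "t' = (m * t' + i) div m" "u' = (m * u' + l) div m" using il by simp_all
      then have "t' = u'" using eq(1) by simp
      then have "i = l" using eq(1) by simp
      have "edge c t = edge c u" using t'(3,4) u'(3,4) \<open>t' = u'\<close> eq(2) by (simp add: edge_def)
      moreover have "t + u < j + k"
      proof -
        have "t \<le> j" "u \<le> k" "j > 0 \<longrightarrow> t < j" "k > 0 \<longrightarrow> u < k"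
          using m by (auto simp: t_def u_def div_less_dividend)
        then show ?thesis using False by linarith
      qed
      ultimately have "t = u" using less.hyps[of t u] by (simp add: same_edge_def)
      then show ?thesis using j k \<open>i = l\<close> by simp
    qed simp
  qed
  then show ?thesis by (simp add: edge_inj_def)
qed

end


section \<open>Simple polygonal loops\<close>

lemma pathstart_polygonal_path: "ps \<noteq> [] \<Longrightarrow> pathstart (polygonal_path ps) = hd ps"
  by (induction ps rule: polygonal_path.induct) simp_all

lemma pathfinish_polygonal_path: "ps \<noteq> [] \<Longrightarrow> pathfinish (polygonal_path ps) = last ps"
  by (induction ps rule: polygonal_path.induct) simp_all

lemma path_image_polygonal_path:
  "length ps = Suc (Suc n) \<Longrightarrow>
    path_image (polygonal_path ps) = (\<Union>l<Suc n. closed_segment (ps ! l) (ps ! Suc l))"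
proof (induction ps arbitrary: n rule: polygonal_path.induct)
  case (4 x y z zs)
  then obtain k where k: "n = Suc k" "length (y # z # zs) = Suc (Suc k)" by (cases n) auto
  have "path_image (polygonal_path (x # y # z # zs)) =
      closed_segment x y \<union> path_image (polygonal_path (y # z # zs))"
    by (simp add: path_image_join pathstart_polygonal_path)
  also have "\<dots> = (\<Union>l<Suc n. closed_segment ((x # y # z # zs) ! l) ((x # y # z # zs) ! Suc l))"
    unfolding "4.IH"[OF k(2)] unfolding k(1) by (subst (2) lessThan_Suc_eq_insert_0) simp
  finally show ?case .
qed (simp_all add: lessThan_Suc)

lemma arc_polygonal_pathI:
  assumes "length ps = Suc (Suc n)"
    and "\<And>l. l < Suc n \<Longrightarrow> ps ! l \<noteq> ps ! Suc l"
    and "\<And>l l' q. l < l' \<Longrightarrow> l' < Suc n \<Longrightarrow> q \<in> closed_segment (ps ! l) (ps ! Suc l) \<Longrightarrow>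
      q \<in> closed_segment (ps ! l') (ps ! Suc l') \<Longrightarrow> l' = Suc l \<and> q = ps ! l'"
  shows "arc (polygonal_path ps)"
  using assms
proof (induction ps arbitrary: n rule: polygonal_path.induct)
  case (3 x y)
  then have "x \<noteq> y" by fastforce
  then show ?case by simp
next
  case (4 x y z zs)
  obtain k where k: "n = Suc k" "length (y # z # zs) = Suc (Suc k)" using "4.prems"(1) by (cases n) auto
  let ?ps = "x # y # z # zs"
  have rest: "arc (polygonal_path (y # z # zs))"
  proof (rule "4.IH"[OF k(2)])
    show "(y # z # zs) ! l \<noteq> (y # z # zs) ! Suc l" if "l < Suc k" for l
      using "4.prems"(2)[of "Suc l"] that k(1) by simp
    show "l' = Suc l \<and> q = (y # z # zs) ! l'"
      if "l < l'" "l' < Suc k" "q \<in> closed_segment ((y # z # zs) ! l) ((y # z # zs) ! Suc l)"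
        "q \<in> closed_segment ((y # z # zs) ! l') ((y # z # zs) ! Suc l')" for l l' q
      using "4.prems"(3)[of "Suc l" "Suc l'" q] that k(1) by simp
  qed
  have "x \<noteq> y" using "4.prems"(2)[of 0] by simp
  have "path_image (linepath x y) \<inter> path_image (polygonal_path (y # z # zs)) \<subseteq> {y}"
  proof
    fix q assume "q \<in> path_image (linepath x y) \<inter> path_image (polygonal_path (y # z # zs))"
    then obtain l where "l < Suc k" "q \<in> closed_segment x y"
      "q \<in> closed_segment ((y # z # zs) ! l) ((y # z # zs) ! Suc l)"
      unfolding path_image_polygonal_path[OF k(2)] by auto
    then have "Suc l = Suc 0 \<and> q = ?ps ! Suc l"
      using "4.prems"(3)[of 0 "Suc l" q] k(1) by simp
    then show "q \<in> {y}" by simp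
  qed
  then show ?case
    using rest \<open>x \<noteq> y\<close> by (simp add: arc_join_eq pathstart_polygonal_path)
qed simp_all

lemma simple_path_polygonal_loop_iff:
  assumes "last (z # zs) = x"
  shows "simple_path (polygonal_path (x # y # z # zs)) \<longleftrightarrow>
    x \<noteq> y \<and> arc (polygonal_path (y # z # zs)) \<and>
    closed_segment x y \<inter> path_image (polygonal_path (y # z # zs)) \<subseteq> {x, y}"
proof -
  have "arc (linepath x y) \<longleftrightarrow> x \<noteq> y"
    by (metis arc_distinct_ends arc_linepath pathfinish_linepath pathstart_linepath)
  then show ?thesis
    using assms
    by (simp add: simple_path_join_loop_eq pathstart_polygonal_path pathfinish_polygonal_path)
qed

lemma arc_polygonal_pathD:
  assumes "arc (polygonal_path ps)" "length ps = Suc (Suc n)" "l < l'" "l' < Suc n"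
    "q \<in> closed_segment (ps ! l) (ps ! Suc l)" "q \<in> closed_segment (ps ! l') (ps ! Suc l')"
  shows "q \<in> set ps"
  using assms
proof (induction ps arbitrary: n l l' rule: polygonal_path.induct)
  case (4 x y z zs)
  obtain k where k: "n = Suc k" "length (y # z # zs) = Suc (Suc k)" using "4.prems"(2) by (cases n) auto
  obtain j where j: "l' = Suc j" "j < Suc k" using "4.prems"(3,4) k(1) by (cases l') auto
  have arcs: "arc (polygonal_path (y # z # zs))"
    "closed_segment x y \<inter> path_image (polygonal_path (y # z # zs)) \<subseteq> {y}"
    using "4.prems"(1) by (simp_all add: arc_join_eq pathstart_polygonal_path)
  show ?case
  proof (cases l)
    case 0
    have "q \<in> path_image (polygonal_path (y # z # zs))"
      unfolding path_image_polygonal_path[OF k(2)] using "4.prems"(6) j by auto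
    moreover have "q \<in> closed_segment x y" using "4.prems"(5) 0 by simp
    ultimately show ?thesis using arcs(2) by auto
  next
    case (Suc i)
    then have "q \<in> set (y # z # zs)"
      using "4.IH"[OF arcs(1) k(2), of i j] "4.prems"(3,5,6) j by simp
    then show ?thesis by simp
  qed
qed auto

lemma simple_polygonal_loopD:
  assumes "simple_path (polygonal_path ps)" "last ps = hd ps" "length ps = Suc (Suc (Suc n))"
    "l < l'" "l' < Suc (Suc n)"
    "q \<in> closed_segment (ps ! l) (ps ! Suc l)" "q \<in> closed_segment (ps ! l') (ps ! Suc l')"
  shows "q \<in> set ps"
proof -
  obtain x y z zs where ps: "ps = x # y # z # zs"
    using assms(3) by (auto simp: length_Suc_conv)
  have len: "length (y # z # zs) = Suc (Suc n)" using assms(3) by (simp add: ps)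
  have last: "last (z # zs) = x" using assms(2) by (simp add: ps)
  have arcs: "arc (polygonal_path (y # z # zs))"
    "closed_segment x y \<inter> path_image (polygonal_path (y # z # zs)) \<subseteq> {x, y}"
    using assms(1) simple_path_polygonal_loop_iff[OF last, of y] by (simp_all only: ps)
  obtain j where j: "l' = Suc j" "j < Suc n" using assms(4,5) by (cases l') auto
  show ?thesis
  proof (cases l)
    case 0
    have "q \<in> path_image (polygonal_path (y # z # zs))"
      unfolding path_image_polygonal_path[OF len] using assms(7) j by (auto simp: ps)
    moreover have "q \<in> closed_segment x y" using assms(6) 0 by (simp add: ps)
    ultimately show ?thesis using arcs(2) by (auto simp: ps)
  next
    case (Suc i)
    then have "q \<in> set (y # z # zs)"
      using arc_polygonal_pathD[OF arcs(1) len, of i j q] assms(4,6,7) j by (simp add: ps)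
    then show ?thesis by (simp add: ps)
  qed
qed

text \<open>
  The second alternative in the condition on meeting pieces is the base point of the loop, which the
  first and the last piece share.
\<close>

lemma simple_polygonal_loopI:
  assumes len: "length ps = Suc (Suc (Suc n))" and loop: "last ps = hd ps"
    and ne: "\<And>l. l < Suc (Suc n) \<Longrightarrow> ps ! l \<noteq> ps ! Suc l"
    and meet: "\<And>l l' q. l < l' \<Longrightarrow> l' < Suc (Suc n) \<Longrightarrow> q \<in> closed_segment (ps ! l) (ps ! Suc l) \<Longrightarrow>
      q \<in> closed_segment (ps ! l') (ps ! Suc l') \<Longrightarrow>
      l' = Suc l \<and> q = ps ! l' \<or> l = 0 \<and> l' = Suc n \<and> q = ps ! 0"
  shows "simple_path (polygonal_path ps)"
proof -
  obtain x y z zs where ps: "ps = x # y # z # zs"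
    using len by (auto simp: length_Suc_conv)
  have len': "length (y # z # zs) = Suc (Suc n)" using len by (simp add: ps)
  have last: "last (z # zs) = x" using loop by (simp add: ps)
  have "arc (polygonal_path (y # z # zs))"
  proof (rule arc_polygonal_pathI[OF len'])
    show "(y # z # zs) ! l \<noteq> (y # z # zs) ! Suc l" if "l < Suc n" for l
      using ne[of "Suc l"] that by (simp add: ps)
    show "l' = Suc l \<and> q = (y # z # zs) ! l'"
      if "l < l'" "l' < Suc n" "q \<in> closed_segment ((y # z # zs) ! l) ((y # z # zs) ! Suc l)"
        "q \<in> closed_segment ((y # z # zs) ! l') ((y # z # zs) ! Suc l')" for l l' q
      using meet[of "Suc l" "Suc l'" q] that by (simp add: ps)
  qed
  moreover have "closed_segment x y \<inter> path_image (polygonal_path (y # z # zs)) \<subseteq> {x, y}"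
  proof
    fix q assume "q \<in> closed_segment x y \<inter> path_image (polygonal_path (y # z # zs))"
    then obtain l where "l < Suc n" "q \<in> closed_segment x y"
      "q \<in> closed_segment ((y # z # zs) ! l) ((y # z # zs) ! Suc l)"
      unfolding path_image_polygonal_path[OF len'] by auto
    then have "Suc l = Suc 0 \<and> q = ps ! Suc l \<or> q = ps ! 0"
      using meet[of 0 "Suc l" q] by (auto simp: ps)
    then show "q \<in> {x, y}" by (auto simp: ps)
  qed
  moreover have "x \<noteq> y" using ne[of 0] by (simp add: ps)
  ultimately show ?thesis
    unfolding ps simple_path_polygonal_loop_iff[OF last] by blast
qed


section \<open>How edges and cut corners meet\<close>

lemma dirs_quotient:
  assumes "f \<in> dirs" "f' \<in> dirs"
  obtains e where "e \<in> dirs" "f' = e * f" "f' * cnj f = e"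
proof
  show "f' * cnj f \<in> dirs" "f' = (f' * cnj f) * f" using assms by (auto simp: dirs_def)
qed simp

lemma Ints_between: "x \<in> \<int> \<Longrightarrow> of_int k < x \<Longrightarrow> x < of_int k + 2 \<Longrightarrow> x = of_int k + (1 :: real)"
proof -
  assume x: "x \<in> \<int>" "of_int k < x" "x < of_int k + 2"
  then obtain z where z: "x = of_int z" by (auto elim: Ints_cases)
  then have "k < z" "z < k + 2" using x(2,3) by linarith+
  then show "x = of_int k + 1" by (simp add: z)
qed

text \<open>
  The point \<open>f (1/2 + s + \<i> t)\<close> runs through a strip across the edge \<open>f\<close>, with \<open>t\<close> measuring the distance
  to the edge. Dividing by \<open>f\<close> reduces to \<open>f = 1\<close>. All points of a perpendicular edge have an integral
  coordinate along \<open>f\<close>, whereas \<open>1/2 + s\<close> lies strictly between \<open>0\<close> and \<open>1\<close>; for a parallel edge \<open>t\<close>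
  is an integer and hence \<open>0\<close>.
\<close>

lemma edge_in_strip:
  fixes s t \<tau> :: real
  assumes p: "p \<in> gauss" "p' \<in> gauss" and f: "f \<in> dirs" "f' \<in> dirs"
    and s: "\<bar>s\<bar> < 1 / 2" and t: "\<bar>t\<bar> \<le> 1 / 2" and \<tau>: "0 < \<tau>" "\<tau> < 1"
    and eq: "p + f * Complex (1 / 2 + s) t = p' + of_real \<tau> * f'"
  shows "t = 0 \<and> same_edge (p, f) (p', f')"
proof -
  obtain e where e: "e \<in> dirs" "f' = e * f" "f' * cnj f = e" by (rule dirs_quotient[OF f])
  define w where "w = (p' - p) * cnj f"
  have f1: "cnj f * f = 1" by (rule dirs_cnj[OF f(1)])
  have w: "p' = p + w * f" using f1 by (simp add: w_def mult.assoc)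
  have wg: "w \<in> gauss" using p f by (simp add: w_def)
  have "f * Complex (1 / 2 + s) t = w * f + of_real \<tau> * (e * f)" using eq by (simp add: w e(2))
  then have "f * Complex (1 / 2 + s) t = f * (w + of_real \<tau> * e)" by (simp add: algebra_simps)
  then have main: "Complex (1 / 2 + s) t = w + of_real \<tau> * e" using dirs_nonzero[OF f(1)] by simp
  have Re: "1 / 2 + s = Re w + \<tau> * Re e" and Im: "t = Im w + \<tau> * Im e"
    using main by (simp_all add: complex_eq_iff)
  have I: "Re w \<in> \<int>" "Im w \<in> \<int>" using wg by (simp_all add: gauss_def)
  from e(1) consider "e = 1" | "e = -1" | "e = \<i> \<or> e = -\<i>" by (auto simp: dirs_def)
  then show ?thesis
  proof cases
    case 1
    have "Im w = 0" using Im I(2) t 1 Ints_between[of "Im w" "-1"] by auto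
    moreover have "Re w = 0" using Re I(1) s \<tau> 1 Ints_between[of "Re w" "-1"] by auto
    ultimately have "w = 0" by (simp add: complex_eq_iff)
    then show ?thesis using Im 1 by (simp add: w e(2) same_edge_def)
  next
    case 2
    have "Im w = 0" using Im I(2) t 2 Ints_between[of "Im w" "-1"] by auto
    moreover have "Re w = 1" using Re I(1) s \<tau> 2 Ints_between[of "Re w" 0] by auto
    ultimately have "w = 1" by (simp add: complex_eq_iff)
    then show ?thesis using Im 2 by (simp add: w e(2) same_edge_def rev_edge_def)
  next
    case 3
    then have "1 / 2 + s = Re w" using Re by auto
    then have "0 < Re w" "Re w < 1" using s by linarith+
    then have False using I(1) Ints_between[of "Re w" 0] by auto
    then show ?thesis ..
  qed
qed

text \<open>
  Every point of a cut corner has all its coordinates within \<open>r\<close> of integers, whereas in the narrower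
  strip the coordinate along the edge stays more than \<open>r\<close> away from them.
\<close>

lemma corner_not_in_strip:
  fixes s t x y r :: real
  assumes p: "p \<in> gauss" "v \<in> gauss" and f: "f \<in> dirs" "d \<in> dirs" "d' \<in> dirs"
    and perp: "d' = \<i> * d \<or> d' = - \<i> * d"
    and xy: "x \<ge> 0" "y \<ge> 0" "x + y = r" and s: "\<bar>s\<bar> < 1 / 2 - r"
    and eq: "p + f * Complex (1 / 2 + s) t = v + of_real x * d + of_real y * d'"
  shows False
proof -
  obtain e where e: "e \<in> dirs" "d = e * f" "d * cnj f = e" by (rule dirs_quotient[OF f(1,2)])
  obtain c where c: "c = \<i> \<or> c = - \<i>" "d' = c * d" using perp by blast
  define w where "w = (v - p) * cnj f"
  have f1: "cnj f * f = 1" by (rule dirs_cnj[OF f(1)])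
  have w: "v = p + w * f" using f1 by (simp add: w_def mult.assoc)
  have wg: "w \<in> gauss" using p f by (simp add: w_def)
  have "f * Complex (1 / 2 + s) t = w * f + of_real x * (e * f) + of_real y * (c * (e * f))"
    using eq by (simp add: w e(2) c(2))
  then have "f * Complex (1 / 2 + s) t = f * (w + of_real x * e + of_real y * (c * e))"
    by (simp add: algebra_simps)
  then have "Complex (1 / 2 + s) t = w + of_real x * e + of_real y * (c * e)"
    using dirs_nonzero[OF f(1)] by simp
  then have Re: "1 / 2 + s = Re w + x * Re e + y * Re (c * e)" by (simp add: complex_eq_iff)
  have "\<bar>x * Re e + y * Re (c * e)\<bar> \<le> r"
    using e(1) c(1) xy by (auto simp: dirs_def)
  then have "0 < Re w" "Re w < 1" using Re s by linarith+
  then show False using wg Ints_between[of "Re w" 0] by (auto simp: gauss_def)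
qed

lemma gauss_small: "w \<in> gauss \<Longrightarrow> \<bar>Re w\<bar> < 1 \<Longrightarrow> \<bar>Im w\<bar> < 1 \<Longrightarrow> w = 0"
  using Ints_between[of "Re w" "-1"] Ints_between[of "Im w" "-1"]
  by (auto simp: gauss_def complex_eq_iff)

lemma corner_bound:
  assumes "d \<in> dirs" "d' = \<i> * d \<or> d' = - \<i> * d" "x \<ge> 0" "y \<ge> 0" "x + y = (r :: real)"
  shows "\<bar>Re (of_real x * d + of_real y * d')\<bar> \<le> r" "\<bar>Im (of_real x * d + of_real y * d')\<bar> \<le> r"
  using assms by (auto simp: dirs_def)

text \<open>
  Since \<open>r < 1/2\<close>, the corners lie at the same lattice point. The segment that cuts off a corner stays in
  one closed quadrant, and two quadrants that meet away from the apex share a ray.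
\<close>

lemma corners_meet:
  fixes x y x' y' r :: real
  assumes v: "v \<in> gauss" "v' \<in> gauss" and d: "d \<in> dirs" "e \<in> dirs"
    and perp: "d' = \<i> * d \<or> d' = - \<i> * d" "e' = \<i> * e \<or> e' = - \<i> * e"
    and xy: "x \<ge> 0" "y \<ge> 0" "x + y = r" "x' \<ge> 0" "y' \<ge> 0" "x' + y' = r" and r: "0 < r" "r < 1 / 2"
    and eq: "v + (of_real x * d + of_real y * d') = v' + (of_real x' * e + of_real y' * e')"
  shows "v = v' \<and> (d = e \<or> d = e' \<or> d' = e \<or> d' = e')"
proof -
  have "v - v' = (of_real x' * e + of_real y' * e') - (of_real x * d + of_real y * d')"
    using eq by (simp add: algebra_simps)
  then have "\<bar>Re (v - v')\<bar> < 1" "\<bar>Im (v - v')\<bar> < 1"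
    using corner_bound[OF d(1) perp(1) xy(1-3)] corner_bound[OF d(2) perp(2) xy(4-6)] r by auto
  then have vv: "v = v'" using gauss_small[of "v - v'"] v by simp
  then have eq': "of_real x * d + of_real y * d' = of_real x' * e + of_real y' * e'" using eq by simp
  obtain k where k: "k \<in> dirs" "e = k * d" by (rule dirs_quotient[OF d])
  obtain c where c: "c = \<i> \<or> c = - \<i>" "d' = c * d" using perp(1) by blast
  obtain c' where c': "c' = \<i> \<or> c' = - \<i>" "e' = c' * e" using perp(2) by blast
  have "(of_real x + of_real y * c) * d = (of_real x' * k + of_real y' * (c' * k)) * d"
    using eq' by (simp add: k c c' algebra_simps)
  then have red: "of_real x + of_real y * c = of_real x' * k + of_real y' * (c' * k)"
    using dirs_nonzero[OF d(1)] by simp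
  have "k = 1 \<or> c' * k = 1 \<or> c = k \<or> c = c' * k"
    using k(1) unfolding dirs_def
  proof (elim insertE emptyE)
    assume "k = - 1"
    then have "x = - x'" using red c(1) c'(1) by (auto simp: complex_eq_iff)
    then have "x = 0" "x' = 0" using xy by linarith+
    then have "of_real r * c = of_real r * (- c')" using red xy \<open>k = - 1\<close> by simp
    then have "c = - c'" unfolding mult_cancel_left using r(1) by simp
    then show ?thesis using \<open>k = - 1\<close> by simp
  next
    assume "k = \<i>"
    then show ?thesis using red c(1) c'(1) xy r(1) by (auto simp: complex_eq_iff)
  next
    assume "k = - \<i>"
    then show ?thesis using red c(1) c'(1) xy r(1) by (auto simp: complex_eq_iff)
  qed simp
  then have "d = e \<or> d = e' \<or> d' = e \<or> d' = e'"
    unfolding k(2) c(2) c'(2) by (metis mult.assoc mult_1)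
  with vv show ?thesis ..
qed

lemma corner_meets_half_edge:
  fixes x y r :: real
  assumes v: "v \<in> gauss" "v' \<in> gauss" and d: "d \<in> dirs" "e \<in> dirs"
    and perp: "d' = \<i> * d \<or> d' = - \<i> * d"
    and xy: "x \<ge> 0" "y \<ge> 0" "x + y = r" and r: "0 < r" "r < 1 / 2"
    and eq: "v + (of_real x * d + of_real y * d') = v' + of_real r * e"
  shows "v = v' \<and> (d = e \<or> d' = e)"
proof -
  have "v - v' = of_real r * e - (of_real x * d + of_real y * d')"
    using eq by (simp add: algebra_simps)
  moreover have "\<bar>Re (of_real r * e)\<bar> \<le> r" "\<bar>Im (of_real r * e)\<bar> \<le> r"
    using d(2) r by (auto simp: dirs_def)
  ultimately have "\<bar>Re (v - v')\<bar> < 1" "\<bar>Im (v - v')\<bar> < 1"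
    using corner_bound[OF d(1) perp(1) xy(1-3)] r by auto
  then have vv: "v = v'" using gauss_small[of "v - v'"] v by simp
  then have eq': "of_real x * d + of_real y * d' = of_real r * e" using eq by simp
  have "d = e \<or> d' = e"
    using d perp eq' xy r by (auto simp: dirs_def complex_eq_iff)
  with vv show ?thesis ..
qed

lemma rounded_edge_iff:
  fixes r :: real and p f q :: complex
  assumes "0 < r" "r < 1 / 2"
  shows "q \<in> closed_segment (p + of_real r * f) (p + f - of_real r * f) \<longleftrightarrow>
    (\<exists>\<tau>. r \<le> \<tau> \<and> \<tau> \<le> 1 - r \<and> q = p + of_real \<tau> * f)"
proof
  assume "q \<in> closed_segment (p + of_real r * f) (p + f - of_real r * f)"
  then obtain u where u: "0 \<le> u" "u \<le> 1"
    "q = (1 - u) *\<^sub>R (p + of_real r * f) + u *\<^sub>R (p + f - of_real r * f)"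
    by (auto simp: in_segment)
  have "0 \<le> u * (1 - 2 * r)" "u * (1 - 2 * r) \<le> 1 * (1 - 2 * r)"
    using u assms by (auto intro!: mult_right_mono)
  moreover have "q = p + of_real (r + u * (1 - 2 * r)) * f"
    unfolding u(3) by (simp add: scaleR_conv_of_real algebra_simps)
  ultimately show "\<exists>\<tau>. r \<le> \<tau> \<and> \<tau> \<le> 1 - r \<and> q = p + of_real \<tau> * f"
    by (intro exI[of _ "r + u * (1 - 2 * r)"]) auto
next
  assume "\<exists>\<tau>. r \<le> \<tau> \<and> \<tau> \<le> 1 - r \<and> q = p + of_real \<tau> * f"
  then obtain \<tau> where \<tau>: "r \<le> \<tau>" "\<tau> \<le> 1 - r" "q = p + of_real \<tau> * f" by blast
  define u where "u = (\<tau> - r) / (1 - 2 * r)"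
  have "0 \<le> u" "u \<le> 1" using \<tau> assms by (auto simp: u_def field_simps)
  moreover have "\<tau> = r + u * (1 - 2 * r)" using assms by (simp add: u_def)
  moreover have "(1 - u) *\<^sub>R (p + of_real r * f) + u *\<^sub>R (p + f - of_real r * f)
      = p + of_real (r + u * (1 - 2 * r)) * f"
    by (simp add: scaleR_conv_of_real algebra_simps)
  ultimately show "q \<in> closed_segment (p + of_real r * f) (p + f - of_real r * f)"
    unfolding in_segment \<tau>(3) by metis
qed

lemma corner_segmentD:
  fixes r :: real and v f f' q :: complex
  assumes "0 < r" "q \<in> closed_segment (v - of_real r * f) (v + of_real r * f')"
  obtains x y where "x \<ge> 0" "y \<ge> 0" "x + y = r" "q = v + (of_real x * (- f) + of_real y * f')"
proof -
  obtain u where u: "0 \<le> u" "u \<le> 1"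
    "q = (1 - u) *\<^sub>R (v - of_real r * f) + u *\<^sub>R (v + of_real r * f')"
    using assms(2) by (auto simp: in_segment)
  show thesis
    by (rule that[of "(1 - u) * r" "u * r"])
      (use u assms(1) in \<open>auto simp: scaleR_conv_of_real algebra_simps\<close>)
qed

text \<open>
  A closed walk is treated as a periodic sequence, so that the corner at the base point is not special.
\<close>


section \<open>Rounded closed walks\<close>

locale rounded_walk =
  fixes h :: "nat \<Rightarrow> complex" and n :: nat and r :: real
  assumes h_turning: "turning h" and h_periodic: "\<And>k. h (k + n) = h k"
    and h_closed: "pos h n = 0" and n_pos: "n > 0" and r: "0 < r" "r < 1 / 2"
begin

lemma h_dirs: "h k \<in> dirs"
  using h_turning by (simp add: turning_def)

lemma h_turn: "h (Suc k) = \<i> * h k \<or> h (Suc k) = - \<i> * h k"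
  using h_turning unfolding turning_def by blast

lemma pos_gauss: "pos h k \<in> gauss"
  using h_dirs by (simp add: pos_def gauss_sum)

lemma pos_periodic: "pos h (k + n) = pos h k"
  using pos_add[of h n k] h_closed h_periodic by (simp add: add.commute)

lemma edge_mod: "edge h (k mod n) = edge h k"
proof -
  have "edge h (j + q * n) = edge h j" for j q
  proof (induction q)
    case (Suc q)
    have "edge h (j + Suc q * n) = edge h ((j + q * n) + n)" by (simp add: algebra_simps)
    also have "\<dots> = edge h (j + q * n)" by (simp add: edge_def pos_periodic h_periodic)
    finally show ?case using Suc by simp
  qed simp
  from this[of "k mod n" "k div n"] show ?thesis by (simp add: mult.commute)
qed

text \<open>
  The points at which corners are cut. Those with indices \<open>2 j\<close> and \<open>2 j + 1\<close> lie on the \<open>j\<close>-th edge near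
  its ends, so even pieces are shortened edges and odd pieces are cut corners.
\<close>

definition mark :: "nat \<Rightarrow> complex" where
  "mark l = (if even l then pos h (l div 2) + of_real r * h (l div 2)
             else pos h (Suc (l div 2)) - of_real r * h (l div 2))"

abbreviation "piece l \<equiv> closed_segment (mark l) (mark (Suc l))"

definition "marks = map mark [0..<Suc (2 * n)]"

lemma mark_even [simp]: "mark (2 * j) = pos h j + of_real r * h j"
  and mark_odd [simp]: "mark (Suc (2 * j)) = pos h (Suc j) - of_real r * h j"
  by (simp_all add: mark_def)

lemma mark_wrap: "mark (2 * n) = mark 0"
  using pos_periodic[of 0] h_periodic[of 0] by (simp add: mark_def)

lemma piece_even_iff:
  "q \<in> piece (2 * j) \<longleftrightarrow> (\<exists>\<tau>. r \<le> \<tau> \<and> \<tau> \<le> 1 - r \<and> q = pos h j + of_real \<tau> * h j)"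
  using rounded_edge_iff[OF r, of q "pos h j" "h j"] by simp

lemma piece_oddD:
  assumes "q \<in> piece (Suc (2 * j))"
  obtains x y where "x \<ge> 0" "y \<ge> 0" "x + y = r"
    "q = pos h (Suc j) + (of_real x * (- h j) + of_real y * h (Suc j))"
proof -
  have "mark (Suc (Suc (2 * j))) = pos h (Suc j) + of_real r * h (Suc j)"
    using mark_even[of "Suc j"] by simp
  then have "q \<in> closed_segment (pos h (Suc j) - of_real r * h j) (pos h (Suc j) + of_real r * h (Suc j))"
    using assms by simp
  then show thesis using corner_segmentD[OF r(1)] that by blast
qed

lemma corner_perp: "h (Suc j) = \<i> * (- h j) \<or> h (Suc j) = - \<i> * (- h j)"
  using h_turn[of j] by auto

lemma corner_dirs: "- h j \<in> dirs"
  using h_dirs by simp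

lemma mark_form:
  "\<exists>v e. v \<in> gauss \<and> e \<in> dirs \<and> mark l = v + of_real r * e"
proof (cases "even l")
  case True
  then show ?thesis using pos_gauss h_dirs by (auto simp: mark_def)
next
  case False
  then have "mark l = pos h (Suc (l div 2)) + of_real r * (- h (l div 2))" by (simp add: mark_def)
  then show ?thesis using pos_gauss corner_dirs by blast
qed

lemma strip_iff:
  assumes p: "p \<in> gauss" and f: "f \<in> dirs" and s: "\<bar>s\<bar> < 1 / 2 - r" and t: "\<bar>t\<bar> \<le> 1 / 2"
  shows "(\<exists>l<2 * n. p + f * Complex (1 / 2 + s) t \<in> piece l) \<longleftrightarrow>
    t = 0 \<and> (\<exists>k<n. same_edge (edge h k) (p, f))"
proof
  let ?q = "p + f * Complex (1 / 2 + s) t"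
  assume "\<exists>l<2 * n. ?q \<in> piece l"
  then obtain l where l: "l < 2 * n" "?q \<in> piece l" by blast
  show "t = 0 \<and> (\<exists>k<n. same_edge (edge h k) (p, f))"
  proof (cases "even l")
    case True
    then obtain j where j: "l = 2 * j" by (rule evenE)
    then obtain \<tau> where \<tau>: "r \<le> \<tau>" "\<tau> \<le> 1 - r" "?q = pos h j + of_real \<tau> * h j"
      using l(2) piece_even_iff by blast
    have "t = 0 \<and> same_edge (p, f) (pos h j, h j)"
      by (rule edge_in_strip[OF p pos_gauss f h_dirs _ t _ _ \<tau>(3)]) (use s r \<tau> in auto)
    then show ?thesis using l(1) j by (auto simp: edge_def same_edge_sym)
  next
    case False
    then obtain j where j: "l = Suc (2 * j)" using oddE by (metis Suc_eq_plus1)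
    then obtain x y where xy: "x \<ge> 0" "y \<ge> 0" "x + y = r"
      "?q = pos h (Suc j) + (of_real x * (- h j) + of_real y * h (Suc j))"
      using l(2) piece_oddD by blast
    then have "?q = pos h (Suc j) + of_real x * (- h j) + of_real y * h (Suc j)" by simp
    from corner_not_in_strip[OF p pos_gauss f corner_dirs h_dirs corner_perp xy(1-3) s this]
    show ?thesis ..
  qed
next
  let ?q = "p + f * Complex (1 / 2 + s) t"
  assume "t = 0 \<and> (\<exists>k<n. same_edge (edge h k) (p, f))"
  then obtain k where k: "t = 0" "k < n" "same_edge (edge h k) (p, f)" by blast
  have c: "Complex (1 / 2 + s) 0 = of_real (1 / 2 + s)" by (simp add: complex_eq_iff)
  from k(3) have "(p, f) = (pos h k, h k) \<or> (p, f) = (pos h k + h k, - h k)"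
    by (auto simp: same_edge_def rev_edge_def edge_def)
  then have "?q \<in> piece (2 * k)"
  proof
    assume "(p, f) = (pos h k, h k)"
    then have "?q = pos h k + of_real (1 / 2 + s) * h k" unfolding k(1) c by (simp add: mult.commute)
    then show ?thesis unfolding piece_even_iff using s by (intro exI[of _ "1 / 2 + s"]) auto
  next
    assume "(p, f) = (pos h k + h k, - h k)"
    then have "?q = pos h k + of_real (1 / 2 - s) * h k" unfolding k(1) c by (simp add: algebra_simps)
    then show ?thesis unfolding piece_even_iff using s by (intro exI[of _ "1 / 2 - s"]) auto
  qed
  then show "\<exists>l<2 * n. ?q \<in> piece l" using k(2) by (intro exI[of _ "2 * k"]) simp
qed

lemma same_edge_mod:
  assumes "edge_inj h {..<n}" "same_edge (edge h j) (edge h k)"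
  shows "j mod n = k mod n"
proof -
  have "same_edge (edge h (j mod n)) (edge h (k mod n))" using assms(2) by (simp only: edge_mod)
  then show ?thesis using assms(1) n_pos by (simp add: edge_inj_def)
qed

lemma edge_neq_rev:
  assumes "edge_inj h {..<n}"
  shows "edge h j \<noteq> rev_edge (edge h k)"
proof
  assume *: "edge h j = rev_edge (edge h k)"
  then have "same_edge (edge h j) (edge h k)" by (simp add: same_edge_def)
  then have "j mod n = k mod n" by (rule same_edge_mod[OF assms])
  then have "edge h j = edge h k" by (metis edge_mod)
  then have "h k = - h k" using * by (simp add: edge_def rev_edge_def)
  then show False using dirs_nonzero[OF h_dirs] by simp
qed

text \<open>
  A shortened edge meets another one only if the edges agree. A cut corner meets a shortened edge only at
  a mark, and there, as well as when two corners meet, an end of one edge agrees with an end of another;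
  without repeated edges this happens only between neighbours.
\<close>

lemma pieces_meet:
  assumes inj: "edge_inj h {..<n}" and l: "l < l'" "l' < 2 * n"
    and q: "q \<in> piece l" "q \<in> piece l'"
  shows "l' = Suc l \<and> q = mark l' \<or> l = 0 \<and> l' = 2 * n - 1 \<and> q = mark 0"
proof -
  have edge_corner: "i = j \<and> q = mark (Suc (2 * i)) \<or> i mod n = Suc j mod n \<and> q = mark (2 * i)"
    if ij: "i < n" "j < n" and qi: "q \<in> piece (2 * i)" and qj: "q \<in> piece (Suc (2 * j))" for i j
  proof -
    obtain \<tau> where \<tau>: "r \<le> \<tau>" "\<tau> \<le> 1 - r" "q = pos h i + of_real \<tau> * h i"
      using qi piece_even_iff by blast
    obtain x y where xy: "x \<ge> 0" "y \<ge> 0" "x + y = r"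
      "q = pos h (Suc j) + (of_real x * (- h j) + of_real y * h (Suc j))"
      using qj piece_oddD by blast
    have "\<tau> = r \<or> \<tau> = 1 - r"
    proof (rule ccontr)
      assume "\<not> ?thesis"
      then have s: "\<bar>\<tau> - 1 / 2\<bar> < 1 / 2 - r" using \<tau> by (auto simp: abs_less_iff)
      have c: "Complex (1 / 2 + (\<tau> - 1 / 2)) 0 = of_real \<tau>" by (simp add: complex_eq_iff)
      have "pos h i + h i * Complex (1 / 2 + (\<tau> - 1 / 2)) 0 = q"
        unfolding c \<tau>(3) by (simp only: mult.commute)
      also have "q = pos h (Suc j) + of_real x * (- h j) + of_real y * h (Suc j)"
        using xy(4) by (simp only: add.assoc)
      finally have "pos h i + h i * Complex (1 / 2 + (\<tau> - 1 / 2)) 0 =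
          pos h (Suc j) + of_real x * (- h j) + of_real y * h (Suc j)" .
      from corner_not_in_strip[OF pos_gauss pos_gauss h_dirs corner_dirs h_dirs corner_perp xy(1-3) s this]
      show False .
    qed
    then show ?thesis
    proof
      assume "\<tau> = r"
      then have qm: "q = mark (2 * i)" using \<tau>(3) by simp
      have "pos h (Suc j) + (of_real x * (- h j) + of_real y * h (Suc j)) = pos h i + of_real r * h i"
        using qm xy(4) by simp
      from corner_meets_half_edge[OF pos_gauss pos_gauss corner_dirs h_dirs corner_perp xy(1-3) r this]
      have "edge h i = rev_edge (edge h j) \<or> edge h i = edge h (Suc j)"
        by (auto simp: edge_def rev_edge_def)
      then have "i mod n = Suc j mod n"
        using edge_neq_rev[OF inj] same_edge_mod[OF inj] by (metis same_edge_def)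
      with qm show ?thesis by blast
    next
      assume "\<tau> = 1 - r"
      then have qm: "q = mark (Suc (2 * i))" unfolding \<tau>(3) mark_odd \<open>\<tau> = 1 - r\<close> by (simp add: algebra_simps)
      have "pos h (Suc j) + (of_real x * (- h j) + of_real y * h (Suc j)) =
          pos h (Suc i) + of_real r * (- h i)"
        using qm xy(4) by simp
      from corner_meets_half_edge[OF pos_gauss pos_gauss corner_dirs corner_dirs corner_perp xy(1-3) r this]
      have v: "pos h (Suc j) = pos h (Suc i)" "h j = h i \<or> h (Suc j) = - h i" by auto
      then have "edge h j = edge h i \<or> edge h (Suc j) = rev_edge (edge h i)"
        by (auto simp: edge_def rev_edge_def)
      then have "edge h j = edge h i" using edge_neq_rev[OF inj] by blast
      then have "j mod n = i mod n" using same_edge_mod[OF inj] by (simp add: same_edge_def)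
      with qm ij show ?thesis by simp
    qed
  qed
  obtain i j where ij: "l = 2 * i \<or> l = Suc (2 * i)" "l' = 2 * j \<or> l' = Suc (2 * j)"
    by (metis oddE evenE Suc_eq_plus1)
  have n: "i < n" "j < n" using ij l by auto
  from ij consider (ee) "l = 2 * i" "l' = 2 * j" | (eo) "l = 2 * i" "l' = Suc (2 * j)" |
    (oe) "l = Suc (2 * i)" "l' = 2 * j" | (oo) "l = Suc (2 * i)" "l' = Suc (2 * j)" by blast
  then show ?thesis
  proof cases
    case ee
    obtain \<tau> where \<tau>: "r \<le> \<tau>" "\<tau> \<le> 1 - r" "q = pos h i + of_real \<tau> * h i"
      using q(1) ee piece_even_iff by blast
    obtain \<sigma> where \<sigma>: "r \<le> \<sigma>" "\<sigma> \<le> 1 - r" "q = pos h j + of_real \<sigma> * h j"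
      using q(2) ee piece_even_iff by blast
    have c: "Complex (1 / 2 + (\<tau> - 1 / 2)) 0 = of_real \<tau>" by (simp add: complex_eq_iff)
    have "pos h i + h i * Complex (1 / 2 + (\<tau> - 1 / 2)) 0 = q"
      unfolding c \<tau>(3) by (simp only: mult.commute)
    then have eq: "pos h i + h i * Complex (1 / 2 + (\<tau> - 1 / 2)) 0 = pos h j + of_real \<sigma> * h j"
      unfolding \<sigma>(3) .
    have "0 = (0 :: real) \<and> same_edge (pos h i, h i) (pos h j, h j)"
      by (rule edge_in_strip[OF pos_gauss pos_gauss h_dirs h_dirs _ _ _ _ eq])
        (use \<tau>(1,2) \<sigma>(1,2) r in linarith)+
    then have "i = j" using inj n by (simp add: edge_inj_def edge_def)
    then show ?thesis using ee l by simp
  next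
    case eo
    from edge_corner[OF n] q eo consider "i = j" "q = mark (Suc (2 * i))" |
      "i mod n = Suc j mod n" "q = mark (2 * i)" by blast
    then show ?thesis
    proof cases
      case 1 then show ?thesis using eo by simp
    next
      case 2
      have "i \<le> j" using eo l by simp
      have "\<not> Suc j < n"
      proof
        assume "Suc j < n"
        then show False using 2(1) \<open>i \<le> j\<close> by simp
      qed
      then have "Suc j = n" using n by simp
      then have "i = 0" using 2(1) n by simp
      then show ?thesis using 2(2) eo \<open>Suc j = n\<close> by auto
    qed
  next
    case oe
    from edge_corner[OF n(2,1)] q oe consider "j = i" | "j mod n = Suc i mod n" "q = mark (2 * j)" by blast
    then show ?thesis
    proof cases
      case 1 then show ?thesis using oe l by simp
    next
      case 2
      have "i < j" using oe l by simp
      then have "j = Suc i" using 2(1) n by simp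
      then show ?thesis using 2(2) oe by simp
    qed
  next
    case oo
    obtain x y where xy: "x \<ge> 0" "y \<ge> 0" "x + y = r"
      "q = pos h (Suc i) + (of_real x * (- h i) + of_real y * h (Suc i))"
      using q(1) oo piece_oddD by blast
    obtain x' y' where xy': "x' \<ge> 0" "y' \<ge> 0" "x' + y' = r"
      "q = pos h (Suc j) + (of_real x' * (- h j) + of_real y' * h (Suc j))"
      using q(2) oo piece_oddD by blast
    have "pos h (Suc i) = pos h (Suc j) \<and>
      (- h i = - h j \<or> - h i = h (Suc j) \<or> h (Suc i) = - h j \<or> h (Suc i) = h (Suc j))"
      by (rule corners_meet[OF pos_gauss pos_gauss corner_dirs corner_dirs corner_perp corner_perp
        xy(1-3) xy'(1-3) r]) (use xy(4) xy'(4) in simp)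
    then have "edge h i = edge h j \<or> edge h (Suc j) = rev_edge (edge h i) \<or>
        edge h (Suc i) = rev_edge (edge h j) \<or> edge h (Suc i) = edge h (Suc j)"
      by (auto simp: edge_def rev_edge_def)
    then have "edge h i = edge h j \<or> edge h (Suc i) = edge h (Suc j)"
      using edge_neq_rev[OF inj] by blast
    then have "i mod n = j mod n \<or> Suc i mod n = Suc j mod n"
      using same_edge_mod[OF inj] by (auto simp: same_edge_def)
    then have "i = j" using n by (auto simp: mod_Suc split: if_splits)
    then show ?thesis using oo l by simp
  qed
qed

lemma mark_neq_Suc: "mark l \<noteq> mark (Suc l)"
proof (cases "even l")
  case True
  then obtain j where j: "l = 2 * j" by (rule evenE)
  have "mark (Suc l) - mark l = of_real (1 - 2 * r) * h j"
    unfolding j mark_even mark_odd by (simp add: algebra_simps)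
  moreover have "of_real (1 - 2 * r) * h j \<noteq> 0"
    using r(2) dirs_nonzero[OF h_dirs] by (simp add: complex_eq_iff)
  ultimately show ?thesis by auto
next
  case False
  then obtain j where j: "l = Suc (2 * j)" using oddE by (metis Suc_eq_plus1)
  have "mark (Suc l) - mark l = of_real r * (h (Suc j) + h j)"
    using mark_even[of "Suc j"] unfolding j mark_odd by (simp add: algebra_simps)
  moreover have "h (Suc j) + h j \<noteq> 0"
    using h_turn[of j] h_dirs[of j] by (auto simp: dirs_def complex_eq_iff)
  ultimately show ?thesis using r(1) by auto
qed

lemma marks_nth: "l \<le> 2 * n \<Longrightarrow> marks ! l = mark l"
  by (simp add: marks_def del: upt_Suc)

lemma set_marks: "set marks = mark ` {..2 * n}"
  by (simp add: marks_def atLeastLessThanSuc_atLeastAtMost atLeast0AtMost del: upt_Suc)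

lemma marks_loop: "last marks = hd marks"
  using mark_wrap n_pos by (simp add: marks_def last_map hd_map del: upt_Suc)

lemma marks_length:
  obtains k where "2 * n = Suc (Suc k)" "length marks = Suc (Suc (Suc k))"
  by (rule that[of "2 * n - 2"]) (use n_pos in \<open>simp_all add: marks_def\<close>)

lemma simple_path_marks_iff: "simple_path (polygonal_path marks) \<longleftrightarrow> edge_inj h {..<n}"
proof
  obtain k where k: "2 * n = Suc (Suc k)" "length marks = Suc (Suc (Suc k))" by (rule marks_length)
  assume inj: "edge_inj h {..<n}"
  show "simple_path (polygonal_path marks)"
  proof (rule simple_polygonal_loopI[OF k(2) marks_loop])
    show "marks ! l \<noteq> marks ! Suc l" if "l < Suc (Suc k)" for l
      using that mark_neq_Suc[of l] marks_nth[of l] marks_nth[of "Suc l"] unfolding k(1) by simp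
    show "l' = Suc l \<and> q = marks ! l' \<or> l = 0 \<and> l' = Suc k \<and> q = marks ! 0"
      if "l < l'" "l' < Suc (Suc k)" "q \<in> closed_segment (marks ! l) (marks ! Suc l)"
        "q \<in> closed_segment (marks ! l') (marks ! Suc l')" for l l' q
    proof -
      have "marks ! l = mark l" "marks ! Suc l = mark (Suc l)" "marks ! l' = mark l'"
        "marks ! Suc l' = mark (Suc l')" "marks ! 0 = mark 0"
        using that(1,2) k(1) by (intro marks_nth; linarith)+
      then show ?thesis using pieces_meet[OF inj, of l l' q] that k(1) by simp
    qed
  qed
next
  obtain k where k: "2 * n = Suc (Suc k)" "length marks = Suc (Suc (Suc k))" by (rule marks_length)
  assume simple: "simple_path (polygonal_path marks)"
  have "\<not> same_edge (edge h i) (edge h j)" if ij: "i < j" "j < n" for i j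
  proof
    assume same: "same_edge (edge h i) (edge h j)"
    \<comment> \<open>The middle of the repeated edge lies on two different pieces, but it is not a mark.\<close>
    let ?q = "pos h i + h i * Complex (1 / 2 + 0) 0"
    have c: "Complex (1 / 2 + 0) 0 = of_real (1 / 2)" by (simp add: complex_eq_iff)
    have q: "?q = pos h i + of_real (1 / 2) * h i" unfolding c by (simp add: mult.commute)
    from same have "(pos h j, h j) = (pos h i, h i) \<or> (pos h j, h j) = (pos h i + h i, - h i)"
      by (auto simp: same_edge_def edge_def rev_edge_def)
    then have q': "?q = pos h j + of_real (1 / 2) * h j" unfolding q by (auto simp: algebra_simps)
    have "?q \<in> piece (2 * i)" "?q \<in> piece (2 * j)"
      unfolding piece_even_iff
      by ((rule exI[of _ "1 / 2"], intro conjI, use r in simp, use r in simp, rule q),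
        (rule exI[of _ "1 / 2"], intro conjI, use r in simp, use r in simp, rule q'))
    then have "?q \<in> set marks"
    proof -
      have "marks ! (2 * i) = mark (2 * i)" "marks ! Suc (2 * i) = mark (Suc (2 * i))"
        "marks ! (2 * j) = mark (2 * j)" "marks ! Suc (2 * j) = mark (Suc (2 * j))"
        using ij by (intro marks_nth; linarith)+
      moreover have "2 * i < 2 * j" "2 * j < Suc (Suc k)" using ij k(1) by linarith+
      ultimately show ?thesis
        using simple_polygonal_loopD[OF simple marks_loop k(2), of "2 * i" "2 * j" ?q]
          \<open>?q \<in> piece (2 * i)\<close> \<open>?q \<in> piece (2 * j)\<close> by simp
    qed
    then obtain l where "?q = mark l" unfolding set_marks by blast
    then obtain v e where ve: "v \<in> gauss" "e \<in> dirs" "?q = v + of_real r * e" using mark_form[of l] by auto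
    have "?q = v + of_real r * e + of_real 0 * (\<i> * e)" using ve(3) by simp
    from corner_not_in_strip[OF pos_gauss ve(1) h_dirs ve(2) _ _ _ _ _ _ this, of r]
    show False using r ve(2) by (simp add: dirs_mult)
  qed
  then show "edge_inj h {..<n}"
    unfolding edge_inj_def by (metis lessThan_iff linorder_neqE_nat same_edge_sym)
qed

lemma path_image_marks: "path_image (polygonal_path marks) = (\<Union>l<2 * n. piece l)"
proof -
  obtain k where k: "2 * n = Suc (Suc k)" "length marks = Suc (Suc (Suc k))" by (rule marks_length)
  show ?thesis
    unfolding path_image_polygonal_path[OF k(2)] unfolding k(1)[symmetric] by (simp add: marks_nth)
qed

end


section \<open>The Jordan curve theorem for rounded walks\<close>

lemma finite_gauss_cball: "finite (gauss \<inter> cball 0 B)"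
proof -
  define N where "N = \<lceil>B\<rceil>"
  have "gauss \<inter> cball 0 B \<subseteq> (\<lambda>(x, y). of_int x + \<i> * of_int y) ` ({- N..N} \<times> {- N..N})"
  proof
    fix a assume a: "a \<in> gauss \<inter> cball 0 B"
    then obtain x y :: int where xy: "a = of_int x + \<i> * of_int y" using gauss_cases by blast
    have "\<bar>Re a\<bar> \<le> B" "\<bar>Im a\<bar> \<le> B"
      using a abs_Re_le_cmod[of a] abs_Im_le_cmod[of a] by auto
    then have "\<bar>of_int x\<bar> \<le> B" "\<bar>of_int y\<bar> \<le> B" by (simp_all add: xy)
    then have "\<bar>x\<bar> \<le> N" "\<bar>y\<bar> \<le> N" unfolding N_def by linarith+
    then show "a \<in> (\<lambda>(x, y). of_int x + \<i> * of_int y) ` ({- N..N} \<times> {- N..N})"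
      by (intro image_eqI[of _ _ "(x, y)"]) (auto simp: xy)
  qed
  then show ?thesis by (rule finite_subset) simp
qed

lemma finite_cells_bounded:
  assumes "bounded A"
  shows "finite (cells \<inter> A)"
proof -
  have "bounded ((\<lambda>c. c - (1 + \<i>) / 2) ` A)"
    using bounded_translation_minus[OF assms, of "(1 + \<i>) / 2"] by simp
  then obtain B where B: "\<And>x. x \<in> (\<lambda>c. c - (1 + \<i>) / 2) ` A \<Longrightarrow> norm x \<le> B"
    unfolding bounded_iff by blast
  have "(\<lambda>c. c - (1 + \<i>) / 2) ` (cells \<inter> A) \<subseteq> gauss \<inter> cball 0 B"
    using B by (auto simp: cells_def)
  then have "finite ((\<lambda>c. c - (1 + \<i>) / 2) ` (cells \<inter> A))"
    by (rule finite_subset) (rule finite_gauss_cball)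
  then show ?thesis by (rule finite_imageD) (simp add: inj_on_def)
qed

lemma inside_segment_iff:
  fixes a b :: "'a :: real_normed_vector"
  assumes "closed_segment a b \<inter> A = {}"
  shows "a \<in> inside A \<longleftrightarrow> b \<in> inside A"
proof -
  have "connected_component (- A) a b"
    unfolding connected_component_def
    by (rule exI[of _ "closed_segment a b"]) (use assms in auto)
  then show ?thesis
    using inside_same_component[of A] connected_component_sym[of "- A"] by blast
qed

lemma edge_sides_cells:
  assumes "fst e \<in> gauss" "snd e \<in> dirs"
  shows "left e \<in> cells" "right e \<in> cells"
proof -
  have "(snd e - 1) * ((1 + \<i>) / 2) \<in> gauss" "snd e * ((1 - \<i>) / 2) - (1 + \<i>) / 2 \<in> gauss"
    using assms(2) by (auto simp: dirs_def gauss_def)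
  then have "fst e + (snd e - 1) * ((1 + \<i>) / 2) \<in> gauss"
    "fst e + (snd e * ((1 - \<i>) / 2) - (1 + \<i>) / 2) \<in> gauss"
    using assms(1) by (blast intro: gauss_add)+
  moreover have "fst e + (snd e - 1) * ((1 + \<i>) / 2) = left e - (1 + \<i>) / 2"
    "fst e + (snd e * ((1 - \<i>) / 2) - (1 + \<i>) / 2) = right e - (1 + \<i>) / 2"
    by (simp_all add: left_def right_def field_simps)
  ultimately show "left e \<in> cells" "right e \<in> cells" by (simp_all only: cells_def mem_Collect_eq)
qed

lemma strip_midline_left: "p + f * Complex (1 / 2 + 0) (1 / 2) = left (p, f)"
proof -
  have "Complex (1 / 2 + 0) (1 / 2) = (1 + \<i>) / 2" by (simp add: complex_eq_iff)
  then show ?thesis by (simp add: left_def)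
qed

lemma strip_midline_right: "p + f * Complex (1 / 2 + 0) (- 1 / 2) = right (p, f)"
proof -
  have "Complex (1 / 2 + 0) (- 1 / 2) = (1 - \<i>) / 2" by (simp add: complex_eq_iff)
  then show ?thesis by (simp add: right_def)
qed

lemma strip_segment:
  assumes "x \<in> closed_segment (p + f * Complex (1 / 2 + s) t) (p + f * Complex (1 / 2 + s') t')"
  obtains u where "0 \<le> u" "u \<le> 1"
    "x = p + f * Complex (1 / 2 + ((1 - u) * s + u * s')) ((1 - u) * t + u * t')"
proof -
  obtain u where u: "0 \<le> u" "u \<le> 1"
    "x = (1 - u) *\<^sub>R (p + f * Complex (1 / 2 + s) t) + u *\<^sub>R (p + f * Complex (1 / 2 + s') t')"
    using assms by (auto simp: in_segment)
  have "x = p + f * Complex (1 / 2 + ((1 - u) * s + u * s')) ((1 - u) * t + u * t')"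
    unfolding u(3) by (simp add: complex_eq_iff algebra_simps)
  with u(1,2) show thesis by (rule that)
qed

context rounded_walk
begin

text \<open>
  Crossing an edge perpendicularly at its middle meets no corner cuts. If the edge is not on the walk,
  the crossing joins the two cells in the complement of the curve, so they are on the same side. If it is,
  the middle of the edge lies on the frontier of the inside and of the outside, both of which are therefore
  present in the two half strips beside it; each half strip is connected, so one cell is inside and the
  other outside. At a turn, consecutive edges share the cell in the corner, whence the inside stays on the
  same side along the walk.
\<close>

lemma closed_walk_encloses:
  assumes inj: "edge_inj h {..<n}"
  shows "\<exists>ccw F. encloses ccw h n F"
proof -
  define \<gamma> where "\<gamma> = path_image (polygonal_path marks)"
  have simple: "simple_path (polygonal_path marks)" using inj simple_path_marks_iff by simp
  have "marks \<noteq> []" by (simp add: marks_def)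
  then have "pathfinish (polygonal_path marks) = pathstart (polygonal_path marks)"
    by (simp add: pathfinish_polygonal_path pathstart_polygonal_path marks_loop)
  from Jordan_inside_outside[OF simple this]
  have bdd: "bounded (inside \<gamma>)" and disj: "inside \<gamma> \<inter> outside \<gamma> = {}"
    and un: "inside \<gamma> \<union> outside \<gamma> = - \<gamma>"
    and fr: "frontier (inside \<gamma>) = \<gamma>" "frontier (outside \<gamma>) = \<gamma>"
    unfolding \<gamma>_def by blast+
  have strip: "p + f * Complex (1 / 2 + s) t \<in> \<gamma> \<longleftrightarrow> t = 0 \<and> (\<exists>k<n. same_edge (edge h k) (p, f))"
    if "p \<in> gauss" "f \<in> dirs" "\<bar>s\<bar> < 1 / 2 - r" "\<bar>t\<bar> \<le> 1 / 2" for p f s t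
    using strip_iff[OF that] by (auto simp: \<gamma>_def path_image_marks)
  have off: "left e \<in> inside \<gamma> \<longleftrightarrow> right e \<in> inside \<gamma>"
    if e: "fst e \<in> gauss" "snd e \<in> dirs" and no: "\<And>k. k < n \<Longrightarrow> \<not> same_edge (edge h k) e" for e
  proof -
    obtain p f where pf: "e = (p, f)" by (cases e)
    have "closed_segment (left e) (right e) \<inter> \<gamma> = {}"
    proof (rule ccontr)
      assume "\<not> ?thesis"
      then obtain x where x: "x \<in> closed_segment (left e) (right e)" "x \<in> \<gamma>" by blast
      obtain u where u: "0 \<le> u" "u \<le> 1"
        "x = p + f * Complex (1 / 2 + ((1 - u) * 0 + u * 0)) ((1 - u) * (1 / 2) + u * (- 1 / 2))"
        using x(1) unfolding pf strip_midline_left[symmetric] strip_midline_right[symmetric]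
        by (rule strip_segment)
      have "\<bar>(1 - u) * (1 / 2) + u * (- 1 / 2)\<bar> \<le> 1 / 2" using u(1,2) by (simp add: abs_le_iff field_simps)
      then have "\<exists>k<n. same_edge (edge h k) (p, f)"
        using x(2) strip[of p f "(1 - u) * 0 + u * 0" "(1 - u) * (1 / 2) + u * (- 1 / 2)"] e r
        unfolding u(3) pf by simp
      then show False using no pf by blast
    qed
    then show ?thesis by (rule inside_segment_iff)
  qed
  have half: "p + f * Complex (1 / 2 + s) t \<in> inside \<gamma> \<longleftrightarrow> p + f * Complex (1 / 2 + 0) t' \<in> inside \<gamma>"
    if pf: "p \<in> gauss" "f \<in> dirs" and s: "\<bar>s\<bar> < 1 / 2 - r" and t: "\<bar>t\<bar> \<le> 1 / 2" "\<bar>t'\<bar> \<le> 1 / 2"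
      and sign: "0 < t \<and> 0 < t' \<or> t < 0 \<and> t' < 0" for p f s t t'
  proof (rule inside_segment_iff, rule ccontr)
    assume "closed_segment (p + f * Complex (1 / 2 + s) t) (p + f * Complex (1 / 2 + 0) t') \<inter> \<gamma> \<noteq> {}"
    then obtain x where x: "x \<in> closed_segment (p + f * Complex (1 / 2 + s) t) (p + f * Complex (1 / 2 + 0) t')"
      "x \<in> \<gamma>" by blast
    obtain u where u: "0 \<le> u" "u \<le> 1"
      "x = p + f * Complex (1 / 2 + ((1 - u) * s + u * 0)) ((1 - u) * t + u * t')"
      using x(1) by (rule strip_segment)
    have "\<bar>(1 - u) * s + u * 0\<bar> \<le> 1 * \<bar>s\<bar>"
      unfolding mult_zero_right add_0_right abs_mult using u by (intro mult_right_mono) auto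
    then have s': "\<bar>(1 - u) * s + u * 0\<bar> < 1 / 2 - r" using s by linarith
    have "t \<in> {- 1 / 2..1 / 2}" "t' \<in> {- 1 / 2..1 / 2}"
      unfolding atLeastAtMost_iff using t by linarith+
    then have "(1 - u) *\<^sub>R t + u *\<^sub>R t' \<in> {- 1 / 2..1 / 2}"
      using u(1,2) by (intro convexD convex_real_interval) simp_all
    then have t'': "\<bar>(1 - u) * t + u * t'\<bar> \<le> 1 / 2"
      unfolding atLeastAtMost_iff real_scaleR_def by linarith
    from sign have "(1 - u) *\<^sub>R t + u *\<^sub>R t' \<in> {0 <..} \<or> (1 - u) *\<^sub>R t + u *\<^sub>R t' \<in> {..< 0}"
    proof
      assume "0 < t \<and> 0 < t'"
      then have "(1 - u) *\<^sub>R t + u *\<^sub>R t' \<in> {0 <..}"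
        using u(1,2) by (intro convexD convex_real_interval) simp_all
      then show ?thesis ..
    next
      assume "t < 0 \<and> t' < 0"
      then have "(1 - u) *\<^sub>R t + u *\<^sub>R t' \<in> {..< 0}"
        using u(1,2) by (intro convexD convex_real_interval) simp_all
      then show ?thesis ..
    qed
    then have "(1 - u) * t + u * t' \<noteq> 0" by auto
    then show False using x(2) strip[OF pf s' t''] unfolding u(3) by simp
  qed
  have sides: "left (edge h k) \<in> inside \<gamma> \<longleftrightarrow> right (edge h k) \<notin> inside \<gamma>" for k
  proof -
    define p f where "p = pos h k" and "f = h k"
    have pf: "p \<in> gauss" "f \<in> dirs" by (simp_all add: p_def f_def pos_gauss h_dirs)
    have e: "edge h k = (p, f)" by (simp add: p_def f_def edge_def)
    have on: "\<exists>j<n. same_edge (edge h j) (p, f)"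
      using edge_mod[of k] n_pos e by (intro exI[of _ "k mod n"]) (simp add: same_edge_def)
    define q where "q = p + f * Complex (1 / 2 + 0) 0"
    have q: "q \<in> \<gamma>" unfolding q_def using strip[OF pf, of 0 0] on r by simp
    have near: "(\<exists>s t. \<bar>s\<bar> < 1 / 2 - r \<and> \<bar>t\<bar> \<le> 1 / 2 \<and> t \<noteq> 0 \<and> p + f * Complex (1 / 2 + s) t \<in> X)"
      if X: "frontier X = \<gamma>" "X \<inter> \<gamma> = {}" for X
    proof -
      have "q \<in> closure X" using q X(1) by (auto simp: frontier_def)
      moreover have "1 / 2 - r > 0" using r by simp
      ultimately obtain x where x: "x \<in> X" "dist x q < 1 / 2 - r"
        unfolding closure_approachable by blast
      define w where "w = (x - q) * cnj f"
      have "x = q + w * f" using dirs_cnj[OF pf(2)] by (simp add: w_def mult.assoc)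
      then have xw: "x = p + f * Complex (1 / 2 + Re w) (Im w)"
        by (simp add: q_def complex_eq_iff algebra_simps)
      have "cmod f = 1" using pf(2) by (auto simp: dirs_def)
      then have "cmod w < 1 / 2 - r" using x(2) by (simp add: w_def norm_mult dist_norm)
      then have w: "\<bar>Re w\<bar> < 1 / 2 - r" "\<bar>Im w\<bar> \<le> 1 / 2"
        using abs_Re_le_cmod[of w] abs_Im_le_cmod[of w] r by linarith+
      have "x \<notin> \<gamma>" using x(1) X(2) by blast
      then have "Im w \<noteq> 0" using strip[OF pf w] on unfolding xw by blast
      then show ?thesis using w x(1) xw by blast
    qed
    have in_iff: "p + f * Complex (1 / 2 + s) t \<in> inside \<gamma> \<longleftrightarrow>
        (if t > 0 then left (p, f) else right (p, f)) \<in> inside \<gamma>"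
      if "\<bar>s\<bar> < 1 / 2 - r" "\<bar>t\<bar> \<le> 1 / 2" "t \<noteq> 0" for s t
    proof (cases "t > 0")
      case True
      then show ?thesis
        using half[OF pf that(1,2), of "1 / 2"] strip_midline_left[of p f] by simp
    next
      case False
      then show ?thesis
        using half[OF pf that(1,2), of "- 1 / 2"] that(3) strip_midline_right[of p f] by simp
    qed
    have "inside \<gamma> \<inter> \<gamma> = {}" "outside \<gamma> \<inter> \<gamma> = {}" using un by blast+
    then obtain s t s' t' where st: "\<bar>s\<bar> < 1 / 2 - r" "\<bar>t\<bar> \<le> 1 / 2" "t \<noteq> 0"
      "p + f * Complex (1 / 2 + s) t \<in> inside \<gamma>"
      and st': "\<bar>s'\<bar> < 1 / 2 - r" "\<bar>t'\<bar> \<le> 1 / 2" "t' \<noteq> 0"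
      "p + f * Complex (1 / 2 + s') t' \<in> outside \<gamma>"
      using near[OF fr(1)] near[OF fr(2)] by blast
    have "p + f * Complex (1 / 2 + s') t' \<notin> inside \<gamma>" using st'(4) disj by blast
    then show ?thesis
      using in_iff[OF st(1-3)] in_iff[OF st'(1-3)] st(4) unfolding e by (simp split: if_splits)
  qed
  define ccw where "ccw \<longleftrightarrow> left (edge h 0) \<in> inside \<gamma>"
  have orient: "left (edge h k) \<in> inside \<gamma> \<longleftrightarrow> ccw" for k
  proof (induction k)
    case (Suc k)
    from h_turn[of k] show ?case
    proof
      assume "h (Suc k) = \<i> * h k"
      then have "left (edge h (Suc k)) = left (edge h k)"
        by (simp add: left_def edge_def field_simps)
      then show ?thesis using Suc by simp
    next
      assume "h (Suc k) = - \<i> * h k"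
      then have "right (edge h (Suc k)) = right (edge h k)"
        by (simp add: right_def edge_def field_simps)
      then show ?thesis using Suc sides[of k] sides[of "Suc k"] by simp
    qed
  qed (simp add: ccw_def)
  have cells_sides: "left (edge h k) \<in> cells" "right (edge h k) \<in> cells" for k
    using edge_sides_cells[of "edge h k"] pos_gauss h_dirs by (simp_all add: edge_def)
  have "encloses ccw h n (cells \<inter> inside \<gamma>)"
    unfolding encloses_def
  proof (intro conjI allI impI)
    show "finite (cells \<inter> inside \<gamma>)" by (rule finite_cells_bounded[OF bdd])
    show "left (edge h k) \<in> cells \<inter> inside \<gamma> \<longleftrightarrow> ccw" for k
      using cells_sides(1)[of k] orient[of k] by blast
    show "right (edge h k) \<in> cells \<inter> inside \<gamma> \<longleftrightarrow> \<not> ccw" for k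
      using cells_sides(2)[of k] orient[of k] sides[of k] by blast
    show "left e \<in> cells \<inter> inside \<gamma> \<longleftrightarrow> right e \<in> cells \<inter> inside \<gamma>"
      if "fst e \<in> gauss" "snd e \<in> dirs" "\<forall>k<n. \<not> same_edge (edge h k) e" for e
      using off[OF that(1,2)] that(3) edge_sides_cells[OF that(1,2)] by blast
  qed blast
  then show ?thesis by blast
qed

end


section \<open>Self-avoiding folding strings\<close>

theorem theorem1:
  fixes S :: "dir list" and r :: real
  assumes "folding_string S" and "0 < r" and "r < 1 / 2"
  shows "self_avoiding S \<longleftrightarrow>
    simple_path (theta_loop r S) \<and> pathfinish (theta_loop r S) = pathstart (theta_loop r S)"
proof -
  define m where "m = Suc (length S)"
  define c where "c = (\<lambda>k. step (edge_seq (fold_limit S) k))"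
  have S: "S \<noteq> []" using assms(1) by (simp add: folding_string_def)
  have m: "m \<ge> 2" using S by (cases S) (simp_all add: m_def)
  have g: "turning (fold_steps S)" unfolding fold_steps_def[abs_def] by (rule edge_seq_turning)
  have loop: "loop S = refine (fold_steps S) m (\<lambda>t. \<i> ^ t)" by (simp add: loop_def m_def)
  have fix_c: "refine (fold_steps S) m c = c"
    unfolding m_def c_def by (rule edge_seq_fixed_point[OF S])
  interpret rounded_walk "loop S" "4 * m" r
  proof
    show "turning (loop S)" unfolding loop using m by (intro refine_turning g square_turning) simp
    show "loop S (k + 4 * m) = loop S k" for k
    proof -
      have "(k + 4 * m) div m = k div m + 4" "(k + 4 * m) mod m = k mod m" using m by simp_all
      then show ?thesis by (simp add: loop refine_def block_def power_add)
    qed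
    show "pos (loop S) (4 * m) = 0"
      unfolding loop using pos_refine_mult[of "fold_steps S" m _ 4] pos_square(4) by (simp add: mult.commute)
  qed (use m assms in simp_all)
  have pts: "theta_loop r S = polygonal_path marks"
  proof -
    let ?u = "theta S [La, Lb, Lc, Ld]"
    have len: "length ?u = 4 * m" by (simp add: length_theta_abcd m_def)
    have st: "step (?u ! k) = loop S k" if "k < 4 * m" for k
      using step_theta_abcd that by (simp add: m_def)
    have v: "vertex ((!) ?u) k = pos (loop S) k" if "k \<le> 4 * m" for k
      unfolding vertex_def pos_def using that st by (intro sum.cong) auto
    have cc: "concat (map (\<lambda>j. [mark (2 * j), mark (Suc (2 * j))]) [0..<j]) = map mark [0..<2 * j]" for j
      by (induction j) simp_all
    have "rounded_points r ?u = concat (map (\<lambda>j. [mark (2 * j), mark (Suc (2 * j))]) [0..<4 * m])"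
      unfolding rounded_points_def len
      by (intro arg_cong[where f = concat] map_cong refl) (simp add: v st del: pos_Suc)
    then have "rounded_points r ?u = map mark [0..<2 * (4 * m)]" by (simp only: cc)
    moreover have "hd (map mark [0..<2 * (4 * m)]) = mark (2 * (4 * m))"
      using mark_wrap m by (simp add: hd_map)
    ultimately show ?thesis
      by (simp add: theta_loop_def rounded_loop_def marks_def)
  qed
  have closed: "pathfinish (polygonal_path marks) = pathstart (polygonal_path marks)"
    using marks_loop by (simp add: pathfinish_polygonal_path pathstart_polygonal_path marks_def)
  have "self_avoiding S \<longleftrightarrow> edge_inj (loop S) {..<4 * m}"
  proof
    assume "self_avoiding S"
    then have "edge_inj (refine (fold_steps S) m c) UNIV"
      unfolding self_avoiding_iff_edge_inj fix_c by (simp add: c_def)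
    then show "edge_inj (loop S) {..<4 * m}"
      unfolding loop
      by (rule loop_edge_inj_of_curve[where s = "fold_limit S"])
        (use fold_limit_equal_turns[OF assms(1)] in \<open>simp_all add: c_def step_edge_seq_Suc\<close>)
  next
    assume inj: "edge_inj (loop S) {..<4 * m}"
    obtain ccw F where enc: "encloses ccw (loop S) (4 * m) F" using closed_walk_encloses[OF inj] by blast
    have ccw using enclosed_area(1)[OF enc[unfolded loop]] m g inj by (simp add: loop)
    then interpret simple_loop "fold_steps S" m F
      using enc inj m g by unfold_locales (simp_all add: loop)
    have "edge_inj c UNIV"
      by (rule curve_edge_inj) (use fix_c m in \<open>simp_all add: c_def edge_seq_turning\<close>)
    then show "self_avoiding S" by (simp add: self_avoiding_iff_edge_inj c_def)
  qed
  then show ?thesis using closed by (simp add: pts simple_path_marks_iff)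
qed

end
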